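(* Let $n\in\mathbb N$ and let $M\in M(2n-1,\mathbb R)$ be a nilpotent matrix with $\Lambda(M)=(n_1,\ldots,n_k;p_1,\ldots,p_k;t)$, and let $\mathfrak g_M=\mathbb R e_0\ltimes_M\mathbb R^{2n-1}$ be the corresponding $2n$-dimensional nilpotent almost abelian Lie algebra. Then $\mathfrak g_M$ admits a complex structure if and only if one of the following conditions holds: (i) $t$ is odd and $p_i$ is even for all $i=1,\dots,k$; (ii) $t$ is odd, $p_i$ is even for all $i=1,\dots,k-1$, $n_k=2$ and $p_k$ is odd; (iii) $t$ is even, $k\ge 2$, and there exists $2\le \ell\le k$ such that $n_{\ell-1}=n_\ell+1$, $p_{\ell-1}$ and $p_\ell$ are odd, and $p_i$ is even for all $i\notin\{\ell-1,\ell\}$.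
   Context: For $A\in M(d,\mathbb R)$, $\mathfrak g_A=\mathbb R e_0\ltimes_A\mathbb R^d$ denotes the $(d+1)$-dimensional real Lie algebra $\mathbb R e_0\oplus\mathbb R^d$ with $[e_0,v]=Av$ and $[v,w]=0$ for $v,w\in\mathbb R^d$ (an almost abelian Lie algebra). A complex structure on a real Lie algebra $\mathfrak g$ is a linear automorphism $j$ of the vector space $\mathfrak g$ with $j^2=-\mathrm{id}$ and $[x,y]+j([jx,y]+[x,jy])-[jx,jy]=0$ for all $x,y\in\mathfrak g$. $\mathcal J_n$ ($n\ge2$) is the $n\times n$ nilpotent Jordan block (ones on the subdiagonal, zeros elsewhere), $0_t$ is the $t\times t$ zero matrix, $\oplus$ denotes block-diagonal sum and $N^{\oplus p}$ the block-diagonal sum of $p$ copies of $N$. For a nonzero nilpotent matrix $M\in M(m,\mathbb R)$, $\Lambda(M)=(n_1,\ldots,n_k;p_1,\ldots,p_k;t)$ means that $M$ is conjugate to $\mathcal J_{n_1}^{\oplus p_1}\oplus\cdots\oplus\mathcal J_{n_k}^{\oplus p_k}\oplus 0_t$, where $k\ge1$, $n_1>\cdots>n_k\ge2$, $p_i>0$ for all $i$, $t\ge0$ and $\sum_i n_ip_i+t=m$. *)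

theory Defs
  imports "Jordan_Normal_Form.VS_Connect"
begin

record ('a, 'm) lie_algebra = "('a, 'm) module" +
  lie_bracket :: "'m \<Rightarrow> 'm \<Rightarrow> 'm" (\<open>\<lbrakk>_,/ _\<rbrakk>\<index>\<close>)

locale real_lie_algebra = vectorspace "class_ring :: real ring" L
  for L :: "(real, 'm, 'z) lie_algebra_scheme" (structure) +
  assumes bracket_closed:
      "x \<in> carrier L \<Longrightarrow> y \<in> carrier L \<Longrightarrow> \<lbrakk>x, y\<rbrakk> \<in> carrier L"
    and bracket_add_left:
      "x \<in> carrier L \<Longrightarrow> y \<in> carrier L \<Longrightarrow> z \<in> carrier L \<Longrightarrow> \<lbrakk>x \<oplus> y, z\<rbrakk> = \<lbrakk>x, z\<rbrakk> \<oplus> \<lbrakk>y, z\<rbrakk>"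
    and bracket_smult_left:
      "x \<in> carrier L \<Longrightarrow> y \<in> carrier L \<Longrightarrow> \<lbrakk>c \<odot> x, y\<rbrakk> = c \<odot> \<lbrakk>x, y\<rbrakk>"
    and bracket_add_right:
      "x \<in> carrier L \<Longrightarrow> y \<in> carrier L \<Longrightarrow> z \<in> carrier L \<Longrightarrow> \<lbrakk>x, y \<oplus> z\<rbrakk> = \<lbrakk>x, y\<rbrakk> \<oplus> \<lbrakk>x, z\<rbrakk>"
    and bracket_smult_right:
      "x \<in> carrier L \<Longrightarrow> y \<in> carrier L \<Longrightarrow> \<lbrakk>x, c \<odot> y\<rbrakk> = c \<odot> \<lbrakk>x, y\<rbrakk>"
    and bracket_self: "x \<in> carrier L \<Longrightarrow> \<lbrakk>x, x\<rbrakk> = \<zero>"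
    and jacobi:
      "x \<in> carrier L \<Longrightarrow> y \<in> carrier L \<Longrightarrow> z \<in> carrier L \<Longrightarrow>
        \<lbrakk>x, \<lbrakk>y, z\<rbrakk>\<rbrakk> \<oplus> \<lbrakk>y, \<lbrakk>z, x\<rbrakk>\<rbrakk> \<oplus> \<lbrakk>z, \<lbrakk>x, y\<rbrakk>\<rbrakk> = \<zero>"

text \<open>
  The values of \<open>j\<close> outside \<open>carrier L\<close> are irrelevant.
\<close>

definition complex_structure ::
  "(real, 'm, 'z) lie_algebra_scheme \<Rightarrow> ('m \<Rightarrow> 'm) \<Rightarrow> bool" where
  "complex_structure L j \<longleftrightarrow>
     j \<in> LinearCombinations.module_hom (class_ring :: real ring) L L \<and>
     bij_betw j (carrier L) (carrier L) \<and>
     (\<forall>x \<in> carrier L. j (j x) = \<ominus>\<^bsub>L\<^esub> x) \<and>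
     (\<forall>x \<in> carrier L. \<forall>y \<in> carrier L.
        (\<lbrakk>x, y\<rbrakk>\<^bsub>L\<^esub> \<oplus>\<^bsub>L\<^esub> j (\<lbrakk>j x, y\<rbrakk>\<^bsub>L\<^esub> \<oplus>\<^bsub>L\<^esub> \<lbrakk>x, j y\<rbrakk>\<^bsub>L\<^esub>)) \<ominus>\<^bsub>L\<^esub> \<lbrakk>j x, j y\<rbrakk>\<^bsub>L\<^esub> = \<zero>\<^bsub>L\<^esub>)"

text \<open>
  The pair \<open>(a, v)\<close> stands for \<open>a e\<^sub>0 + v\<close>.  The bracket is the bilinear alternating extension of
  \<open>[e\<^sub>0, v] = A v\<close> and \<open>[v, w] = 0\<close>.  The fields \<open>mult\<close> and \<open>one\<close> are an artefact of the
  record \<open>module\<close>, which extends \<open>ring\<close>; they play no role for modules.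
\<close>

definition almost_abelian :: "real mat \<Rightarrow> (real, real \<times> real vec) lie_algebra" where
  "almost_abelian A =
    \<lparr> carrier = UNIV \<times> carrier_vec (dim_row A),
      mult = undefined,
      one = undefined,
      zero = (0, 0\<^sub>v (dim_row A)),
      add = (\<lambda>(a, v) (b, w). (a + b, v + w)),
      smult = (\<lambda>c (a, v). (c * a, c \<cdot>\<^sub>v v)),
      lie_bracket = (\<lambda>(a, v) (b, w). (0, a \<cdot>\<^sub>v (A *\<^sub>v w) - b \<cdot>\<^sub>v (A *\<^sub>v v))) \<rparr>"

lemma almost_abelian_real_lie_algebra:
  assumes A: "A \<in> carrier_mat d d"
  shows "real_lie_algebra (almost_abelian A)"
proof -
  have d: "dim_row A = d" using A by simp
  let ?L = "almost_abelian A"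
  have ab: "abelian_group ?L"
  proof (rule abelian_groupI)
    fix x assume "x \<in> carrier ?L"
    then obtain a v where x: "x = (a, v)" and v: "v \<in> carrier_vec d"
      by (auto simp: almost_abelian_def d)
    show "\<exists>y \<in> carrier ?L. y \<oplus>\<^bsub>?L\<^esub> x = \<zero>\<^bsub>?L\<^esub>"
      by (rule bexI[of _ "(-a, -v)"]) (use x v d in \<open>auto simp: almost_abelian_def\<close>)
  qed (auto simp: almost_abelian_def d comm_add_vec)
  have "Module.module (class_ring :: real ring) ?L"
    using ab fieldE(1)[OF class_field]
    by (intro Module.module.intro module_axioms.intro)
      (auto simp: almost_abelian_def d algebra_simps smult_add_distrib_vec add_smult_distrib_vec
        smult_smult_assoc)
  hence vs: "vectorspace (class_ring :: real ring) ?L"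
    by (simp add: vectorspace_def class_field)
  note mv = mult_add_distrib_mat_vec[OF A] mult_minus_distrib_mat_vec[OF A] mult_mat_vec[OF A]
    mult_mat_vec_carrier[OF A]
  have Av: "A *\<^sub>v v \<in> carrier_vec d" for v
    using A unfolding carrier_vec_def by simp
  show ?thesis
    apply (intro real_lie_algebra.intro vs real_lie_algebra_axioms.intro)
          apply (auto simp: almost_abelian_def d mv Av)
         apply (rule eq_vecI; use A in \<open>auto simp: algebra_simps simp del: index_mult_mat_vec\<close>)+
    done
qed

definition nilpotent_mat :: "real mat \<Rightarrow> bool" where
  "nilpotent_mat M \<longleftrightarrow> (\<exists>r. M ^\<^sub>m r = 0\<^sub>m (dim_row M) (dim_col M))"

text \<open>
  The library's \<open>jordan_block n 0\<close> has its ones on the superdiagonal.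
\<close>

definition nilpotent_jordan_block :: "nat \<Rightarrow> real mat" where
  "nilpotent_jordan_block n = mat n n (\<lambda>(i, j). if i = Suc j then 1 else 0)"

text \<open>
  \<open>jordan_type M k ns ps t\<close> states \<open>\<Lambda>(M) = (n\<^sub>1, \<dots>, n\<^sub>k; p\<^sub>1, \<dots>, p\<^sub>k; t)\<close> with \<open>n\<^sub>i = ns i\<close> and
  \<open>p\<^sub>i = ps i\<close>.  Only the values of \<open>ns\<close> and \<open>ps\<close> on \<open>{1..k}\<close> matter.
\<close>

definition jordan_type ::
  "real mat \<Rightarrow> nat \<Rightarrow> (nat \<Rightarrow> nat) \<Rightarrow> (nat \<Rightarrow> nat) \<Rightarrow> nat \<Rightarrow> bool" where
  "jordan_type M k ns ps t \<longleftrightarrow>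
     k \<ge> 1 \<and>
     (\<forall>i \<in> {1..k}. \<forall>i' \<in> {1..k}. i < i' \<longrightarrow> ns i' < ns i) \<and>
     (\<forall>i \<in> {1..k}. ns i \<ge> 2) \<and>
     (\<forall>i \<in> {1..k}. ps i > 0) \<and>
     (\<Sum>i = 1..k. ns i * ps i) + t = dim_row M \<and>
     similar_mat M
       (diag_block_mat
         (concat (map (\<lambda>i. replicate (ps i) (nilpotent_jordan_block (ns i))) [1..<Suc k])
           @ [0\<^sub>m t t]))"

end

theory Submission
  imports Defs
begin

text \<open>
  Write \<open>V\<close> for the abelian ideal of dimension \<open>d = 2n - 1\<close>.  A complex structure \<open>j\<close> amounts to the
  hyperplane \<open>\<aa> = V \<inter> jV\<close> of \<open>V\<close>, which integrability forces to be \<open>M\<close>-invariant, together with a complex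
  structure on \<open>\<aa>\<close> commuting with \<open>M\<close>; such a pair extends back to \<open>j\<close> by exchanging \<open>e\<^sub>0\<close> with a
  vector of \<open>V\<close> outside \<open>\<aa>\<close>.

  Given \<open>j\<close>, the space \<open>\<aa> \<inter> ker M\<^sup>i\<close> is \<open>j\<close>-stable, hence even-dimensional, so \<open>dim ker M\<^sup>i\<close> is even precisely
  when \<open>ker M\<^sup>i \<subseteq> \<aa>\<close>, that is, for all \<open>i\<close> below some threshold \<open>s \<ge> 1\<close>.  The number of Jordan blocks
  of size \<open>i\<close> is \<open>2 dim ker M\<^sup>i - dim ker M\<^bsup>i+1\<^esup> - dim ker M\<^bsup>i-1\<^esup>\<close>, so it is odd precisely for
  \<open>i \<in> {s - 1, s}\<close>; the cases \<open>s = 1\<close>, \<open>s = 2\<close>, \<open>s \<ge> 3\<close> are (i), (ii), (iii).  Conversely, shortening one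
  block of size \<open>s\<close> by one turns \<open>M\<close> into a matrix whose blocks come in equal pairs.
\<close>

section \<open>Complex structures from invariant hyperplanes\<close>

text \<open>Such an \<open>A\<close> is a complex-linear map regarded as a real one, with
  \<open>J\<close> as multiplication by the imaginary unit. The conditions are put on vectors
  because block sums are evaluated on vectors below.\<close>

definition commuting_cs :: "real mat \<Rightarrow> bool" where
  "commuting_cs A \<longleftrightarrow> (\<exists>J \<in> carrier_mat (dim_row A) (dim_row A). \<forall>v \<in> carrier_vec (dim_row A).
     J *\<^sub>v (J *\<^sub>v v) = - v \<and> A *\<^sub>v (J *\<^sub>v v) = J *\<^sub>v (A *\<^sub>v v))"

text \<open>
  \<open>J\<close> is a complex structure on the \<open>A\<close>-invariant hyperplane \<open>ker \<phi>\<close> that commutes with \<open>A\<close> there;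
  it is extended to the whole space by \<open>0\<close> on the complementary line spanned by \<open>e\<close>.
\<close>

definition hyperplane_cs :: "nat \<Rightarrow> real mat \<Rightarrow> real mat \<Rightarrow> real vec \<Rightarrow> real vec \<Rightarrow> bool" where
  "hyperplane_cs d A J e \<phi> \<longleftrightarrow>
     J \<in> carrier_mat d d \<and> e \<in> carrier_vec d \<and> \<phi> \<in> carrier_vec d \<and>
     \<phi> \<bullet> e = 1 \<and> J *\<^sub>v e = 0\<^sub>v d \<and>
     (\<forall>v \<in> carrier_vec d. J *\<^sub>v (J *\<^sub>v v) = (\<phi> \<bullet> v) \<cdot>\<^sub>v e - v \<and> \<phi> \<bullet> (J *\<^sub>v v) = 0 \<and>
       \<phi> \<bullet> (A *\<^sub>v v) = 0 \<and> (\<phi> \<bullet> v = 0 \<longrightarrow> A *\<^sub>v (J *\<^sub>v v) = J *\<^sub>v (A *\<^sub>v v)))"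

lemma almost_abelian_simps [simp]:
  "carrier (almost_abelian A) = UNIV \<times> carrier_vec (dim_row A)"
  "\<zero>\<^bsub>almost_abelian A\<^esub> = (0, 0\<^sub>v (dim_row A))"
  "(a, v) \<oplus>\<^bsub>almost_abelian A\<^esub> (b, w) = (a + b, v + w)"
  "c \<odot>\<^bsub>almost_abelian A\<^esub> (a, v) = (c * a, c \<cdot>\<^sub>v v)"
  "\<lbrakk>(a, v), (b, w)\<rbrakk>\<^bsub>almost_abelian A\<^esub> = (0, a \<cdot>\<^sub>v (A *\<^sub>v w) - b \<cdot>\<^sub>v (A *\<^sub>v v))"
  by (simp_all add: almost_abelian_def)

lemma almost_abelian_uminus:
  assumes "A \<in> carrier_mat d d" "v \<in> carrier_vec d"
  shows "\<ominus>\<^bsub>almost_abelian A\<^esub> (a, v) = (- a, - v)"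
proof -
  interpret real_lie_algebra "almost_abelian A"
    by (rule almost_abelian_real_lie_algebra[OF assms(1)])
  show ?thesis
    by (rule minus_equality) (use assms in auto)
qed

lemma almost_abelian_minus:
  assumes "A \<in> carrier_mat d d" "v \<in> carrier_vec d" "w \<in> carrier_vec d"
  shows "(a, v) \<ominus>\<^bsub>almost_abelian A\<^esub> (b, w) = (a - b, v - w)"
  using assms by (simp add: a_minus_def almost_abelian_uminus minus_add_uminus_vec[of _ d])

lemma hyperplane_csD:
  assumes "hyperplane_cs d A J e \<phi>"
  shows "J \<in> carrier_mat d d" "e \<in> carrier_vec d" "\<phi> \<in> carrier_vec d" "\<phi> \<bullet> e = 1" "J *\<^sub>v e = 0\<^sub>v d"
    and "v \<in> carrier_vec d \<Longrightarrow> J *\<^sub>v (J *\<^sub>v v) = (\<phi> \<bullet> v) \<cdot>\<^sub>v e - v"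
    and "v \<in> carrier_vec d \<Longrightarrow> \<phi> \<bullet> (J *\<^sub>v v) = 0"
    and "v \<in> carrier_vec d \<Longrightarrow> \<phi> \<bullet> (A *\<^sub>v v) = 0"
    and "v \<in> carrier_vec d \<Longrightarrow> \<phi> \<bullet> v = 0 \<Longrightarrow> A *\<^sub>v (J *\<^sub>v v) = J *\<^sub>v (A *\<^sub>v v)"
  using assms by (auto simp: hyperplane_cs_def)

text \<open>
  The complex structure is \<open>J\<close> on \<open>ker \<phi>\<close> and sends \<open>e\<close> to \<open>e\<^sub>0\<close> and \<open>e\<^sub>0\<close> to \<open>- e\<close>.
\<close>

lemma complex_structure_almost_abelian_if_hyperplane_cs:
  assumes A: "A \<in> carrier_mat d d" and "hyperplane_cs d A J e \<phi>"
  shows "complex_structure (almost_abelian A) (\<lambda>(a, v). (\<phi> \<bullet> v, J *\<^sub>v v - a \<cdot>\<^sub>v e))"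
    (is "complex_structure ?L ?j")
proof -
  note h = hyperplane_csD[OF assms(2)]
  note J = h(1) and e = h(2) and \<phi> = h(3) and \<phi>e = h(4) and Je = h(5) and JJ = h(6)
    and \<phi>J = h(7) and \<phi>A = h(8) and comm = h(9)
  have d: "dim_row A = d" using A by simp
  note mv = mult_add_distrib_mat_vec[OF A] mult_minus_distrib_mat_vec[OF A] mult_mat_vec[OF A]
    mult_add_distrib_mat_vec[OF J] mult_minus_distrib_mat_vec[OF J] mult_mat_vec[OF J]
    scalar_prod_add_distrib[OF \<phi>] scalar_prod_minus_distrib[OF \<phi>] scalar_prod_smult_distrib[OF \<phi>]
  have Av: "A *\<^sub>v v \<in> carrier_vec d" and Jv: "J *\<^sub>v v \<in> carrier_vec d" for v
    using A J unfolding carrier_vec_def by simp_all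
  note [simp] = Av Jv e \<phi> d carrier_vecD[OF e] carrier_vecD[OF \<phi>] carrier_matD[OF J]
  \<comment> \<open>Commutation is given on the hyperplane only. Projecting \<open>v\<close> along
    \<open>e\<close> does not change \<open>J *\<^sub>v v\<close>, as \<open>J\<close> kills
    \<open>e\<close>, and produces the correction term.\<close>
  have AJ: "A *\<^sub>v (J *\<^sub>v v) = J *\<^sub>v (A *\<^sub>v v) - (\<phi> \<bullet> v) \<cdot>\<^sub>v (J *\<^sub>v (A *\<^sub>v e))"
    if v [simp]: "v \<in> carrier_vec d" for v
  proof -
    define w where "w = v - (\<phi> \<bullet> v) \<cdot>\<^sub>v e"
    have w: "w \<in> carrier_vec d" "\<phi> \<bullet> w = 0" by (simp_all add: w_def mv \<phi>e)
    have "J *\<^sub>v w = J *\<^sub>v v" by (auto simp: w_def mv Je)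
    hence "A *\<^sub>v (J *\<^sub>v v) = J *\<^sub>v (A *\<^sub>v w)" using comm[OF w] by simp
    thus ?thesis by (simp add: w_def mv)
  qed
  have jj: "?j (?j x) = \<ominus>\<^bsub>?L\<^esub> x" if xL: "x \<in> carrier ?L" for x
  proof -
    obtain a v where x: "x = (a, v)" and v: "v \<in> carrier_vec d" using xL by auto
    show ?thesis unfolding x almost_abelian_uminus[OF A v]
      using v by (auto simp: mv \<phi>J \<phi>e JJ Je)
  qed
  have closed: "?j x \<in> carrier ?L" if "x \<in> carrier ?L" for x using that by auto
  \<comment> \<open>By \<open>jj\<close> the fourth power of the map is the identity, so its cube is
    its inverse.\<close>
  have bij: "bij_betw ?j (carrier ?L) (carrier ?L)"
  proof (rule bij_betw_byWitness[where f' = "\<lambda>x. ?j (?j (?j x))"])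
    interpret real_lie_algebra ?L by (rule almost_abelian_real_lie_algebra[OF A])
    have "?j (?j (?j (?j x))) = x" if x: "x \<in> carrier ?L" for x
      using trans[OF jj[OF closed[OF closed[OF x]]] arg_cong[OF jj[OF x], of "\<lambda>x. \<ominus>\<^bsub>?L\<^esub> x"]]
        minus_minus[OF x] by (rule trans)
    thus "\<forall>x\<in>carrier ?L. ?j (?j (?j (?j x))) = x" "\<forall>x\<in>carrier ?L. ?j (?j (?j (?j x))) = x"
      by blast+
    show "?j ` carrier ?L \<subseteq> carrier ?L" "(\<lambda>x. ?j (?j (?j x))) ` carrier ?L \<subseteq> carrier ?L"
      using closed by blast+
  qed
  have hom: "?j \<in> LinearCombinations.module_hom (class_ring :: real ring) ?L ?L"
    by (auto simp: LinearCombinations.module_hom_def mv algebra_simps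
        intro!: eq_vecI simp del: index_mult_mat_vec)
  \<comment> \<open>All brackets are values of \<open>A\<close>, on which \<open>\<phi>\<close>
    vanishes, so the first component is 0. In the second, the corrections from \<open>AJ\<close> for
    \<open>v\<close> and for \<open>w\<close> are the same multiple of
    \<open>J *\<^sub>v (A *\<^sub>v e)\<close> with opposite signs.\<close>
  have nij: "(\<lbrakk>x, y\<rbrakk>\<^bsub>?L\<^esub> \<oplus>\<^bsub>?L\<^esub> ?j (\<lbrakk>?j x, y\<rbrakk>\<^bsub>?L\<^esub> \<oplus>\<^bsub>?L\<^esub> \<lbrakk>x, ?j y\<rbrakk>\<^bsub>?L\<^esub>)) \<ominus>\<^bsub>?L\<^esub> \<lbrakk>?j x, ?j y\<rbrakk>\<^bsub>?L\<^esub>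
      = \<zero>\<^bsub>?L\<^esub>" if xy: "x \<in> carrier ?L" "y \<in> carrier ?L" for x y
  proof -
    obtain a v b w where x: "x = (a, v)" and y: "y = (b, w)"
      and [simp]: "v \<in> carrier_vec d" "w \<in> carrier_vec d"
      using xy by (cases x; cases y) auto
    show ?thesis unfolding x y
      by (auto simp: almost_abelian_minus[OF A] mv AJ JJ \<phi>A \<phi>J algebra_simps
          intro!: eq_vecI simp del: index_mult_mat_vec)
  qed
  show ?thesis unfolding complex_structure_def
    by (intro conjI ballI hom bij jj nij)
qed


section \<open>Transport along similarity\<close>

lemma mult_mat_vec_similar:
  assumes "A \<in> carrier_mat d d" "similar_mat_wit A B P Q" "v \<in> carrier_vec d"
  shows "A *\<^sub>v v = P *\<^sub>v (B *\<^sub>v (Q *\<^sub>v v))" "P *\<^sub>v (Q *\<^sub>v v) = v" "Q *\<^sub>v (P *\<^sub>v v) = v"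
proof -
  note w = similar_mat_witD2[OF assms(1,2)]
  show "A *\<^sub>v v = P *\<^sub>v (B *\<^sub>v (Q *\<^sub>v v))"
    unfolding w(3) using w(5-7) assms(3) by (simp add: assoc_mult_mat_vec[of _ d d _ d])
  show "P *\<^sub>v (Q *\<^sub>v v) = v" "Q *\<^sub>v (P *\<^sub>v v) = v"
    using w(1,2,6,7) assms(3) by (simp_all flip: assoc_mult_mat_vec[of _ d d _ d])
qed

definition admits_hyperplane_cs :: "real mat \<Rightarrow> bool" where
  "admits_hyperplane_cs A \<longleftrightarrow> (\<exists>J e \<phi>. hyperplane_cs (dim_row A) A J e \<phi>)"

text \<open>The data follow the change of basis: \<open>J\<close> is conjugated, \<open>e\<close>
  moves as a vector by \<open>P\<close>, and \<open>\<phi>\<close> moves as a covector by the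
  transpose of \<open>Q\<close>.\<close>

lemma admits_hyperplane_cs_similar:
  assumes A: "A \<in> carrier_mat d d" and sim: "similar_mat A B" and B: "admits_hyperplane_cs B"
  shows "admits_hyperplane_cs A"
proof -
  obtain P Q where wit: "similar_mat_wit A B P Q" using sim by (auto simp: similar_mat_def)
  note w = similar_mat_witD2[OF A wit]
  have P: "P \<in> carrier_mat d d" and Q: "Q \<in> carrier_mat d d" and Bc: "B \<in> carrier_mat d d"
    using w by auto
  obtain J e \<phi> where h: "hyperplane_cs d B J e \<phi>"
    using B Bc by (auto simp: admits_hyperplane_cs_def)
  note h = hyperplane_csD[OF h]
  have car: "P *\<^sub>v v \<in> carrier_vec d" "Q *\<^sub>v v \<in> carrier_vec d" "J *\<^sub>v v \<in> carrier_vec d"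
    "B *\<^sub>v v \<in> carrier_vec d" for v
    using P Q h(1) Bc unfolding carrier_vec_def by simp_all
  define R where "R = P * J * Q"
  have R: "R \<in> carrier_mat d d" unfolding R_def using P Q h(1) by auto
  have Rv: "R *\<^sub>v v = P *\<^sub>v (J *\<^sub>v (Q *\<^sub>v v))" if "v \<in> carrier_vec d" for v
    unfolding R_def using P h(1) Q that by (simp add: assoc_mult_mat_vec[of _ d d _ d])
  have P0: "P *\<^sub>v 0\<^sub>v d = 0\<^sub>v d" using P by (intro eq_vecI) auto
  note sim = mult_mat_vec_similar[OF A wit] and tr = transpose_vec_mult_scalar[OF Q _ h(3)]
    and Pd = mult_minus_distrib_mat_vec[OF P] mult_mat_vec[OF P]
  have "hyperplane_cs d A R (P *\<^sub>v e) (transpose_mat Q *\<^sub>v \<phi>)"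
    unfolding hyperplane_cs_def
  proof (intro conjI ballI impI)
    fix v :: "real vec" assume v: "v \<in> carrier_vec d"
    show "R *\<^sub>v (R *\<^sub>v v) = ((transpose_mat Q *\<^sub>v \<phi>) \<bullet> v) \<cdot>\<^sub>v (P *\<^sub>v e) - v"
      using v by (simp add: Rv car sim(2,3) h tr Pd)
    show "(transpose_mat Q *\<^sub>v \<phi>) \<bullet> (R *\<^sub>v v) = 0"
      using v by (simp add: Rv car sim(2,3) h tr)
    show "(transpose_mat Q *\<^sub>v \<phi>) \<bullet> (A *\<^sub>v v) = 0"
      using v by (simp add: sim car h tr)
    assume "(transpose_mat Q *\<^sub>v \<phi>) \<bullet> v = 0"
    thus "A *\<^sub>v (R *\<^sub>v v) = R *\<^sub>v (A *\<^sub>v v)"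
      using v by (simp add: Rv sim(1) sim(2,3) car h(9) tr)
  qed (use P Q h R in \<open>simp_all add: Rv car sim(2,3) tr P0\<close>)
  thus ?thesis using A unfolding admits_hyperplane_cs_def by auto
qed

section \<open>Direct sums\<close>

definition mat_dsum :: "real mat \<Rightarrow> real mat \<Rightarrow> real mat" where
  "mat_dsum A B =
    four_block_mat A (0\<^sub>m (dim_row A) (dim_col B)) (0\<^sub>m (dim_row B) (dim_col A)) B"

lemma dim_mat_dsum [simp]:
  "dim_row (mat_dsum A B) = dim_row A + dim_row B" "dim_col (mat_dsum A B) = dim_col A + dim_col B"
  by (simp_all add: mat_dsum_def)

lemma mat_dsum_mult_vec:
  assumes "A \<in> carrier_mat m n" "B \<in> carrier_mat m' n'" "v \<in> carrier_vec n" "w \<in> carrier_vec n'"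
  shows "mat_dsum A B *\<^sub>v (v @\<^sub>v w) = A *\<^sub>v v @\<^sub>v B *\<^sub>v w"
proof -
  have "A *\<^sub>v v + 0\<^sub>m m n' *\<^sub>v w = A *\<^sub>v v" "0\<^sub>m m' n *\<^sub>v v + B *\<^sub>v w = B *\<^sub>v w"
    using assms by (auto intro!: eq_vecI)
  thus ?thesis
    using four_block_mat_mult_vec[OF assms(1) zero_carrier_mat zero_carrier_mat assms(2-4)] assms(1,2)
    by (simp add: mat_dsum_def)
qed

lemma smult_append_vec: "c \<cdot>\<^sub>v (v @\<^sub>v w) = c \<cdot>\<^sub>v v @\<^sub>v c \<cdot>\<^sub>v w" for c :: real
  by (rule eq_vecI) auto

lemma uminus_append_vec: "- (v @\<^sub>v w) = - v @\<^sub>v - w" for v w :: "real vec"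
  by (rule eq_vecI) auto

lemma minus_append_vec:
  "v \<in> carrier_vec n \<Longrightarrow> v' \<in> carrier_vec n \<Longrightarrow> w \<in> carrier_vec m \<Longrightarrow> w' \<in> carrier_vec m \<Longrightarrow>
    (v @\<^sub>v w) - (v' @\<^sub>v w') = (v - v') @\<^sub>v (w - w')" for v w :: "real vec"
  by (rule eq_vecI) auto

lemma commuting_csE:
  assumes "commuting_cs A" "A \<in> carrier_mat d d"
  obtains J where "J \<in> carrier_mat d d" "\<And>v. v \<in> carrier_vec d \<Longrightarrow> J *\<^sub>v (J *\<^sub>v v) = - v"
    "\<And>v. v \<in> carrier_vec d \<Longrightarrow> A *\<^sub>v (J *\<^sub>v v) = J *\<^sub>v (A *\<^sub>v v)"
  using assms unfolding commuting_cs_def by auto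

lemma commuting_cs_dsum:
  assumes A: "A \<in> carrier_mat m m" "commuting_cs A" and B: "B \<in> carrier_mat n n" "commuting_cs B"
  shows "commuting_cs (mat_dsum A B)"
proof -
  obtain J where J: "J \<in> carrier_mat m m" "\<And>v. v \<in> carrier_vec m \<Longrightarrow> J *\<^sub>v (J *\<^sub>v v) = - v"
    "\<And>v. v \<in> carrier_vec m \<Longrightarrow> A *\<^sub>v (J *\<^sub>v v) = J *\<^sub>v (A *\<^sub>v v)"
    using commuting_csE[OF A(2,1)] by blast
  obtain K where K: "K \<in> carrier_mat n n" "\<And>v. v \<in> carrier_vec n \<Longrightarrow> K *\<^sub>v (K *\<^sub>v v) = - v"
    "\<And>v. v \<in> carrier_vec n \<Longrightarrow> B *\<^sub>v (K *\<^sub>v v) = K *\<^sub>v (B *\<^sub>v v)"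
    using commuting_csE[OF B(2,1)] by blast
  have [simp]: "A *\<^sub>v v \<in> carrier_vec m" "J *\<^sub>v v \<in> carrier_vec m"
    "B *\<^sub>v v \<in> carrier_vec n" "K *\<^sub>v v \<in> carrier_vec n" for v
    using A B J K unfolding carrier_vec_def by simp_all
  have "\<forall>v \<in> carrier_vec (m + n). mat_dsum J K *\<^sub>v (mat_dsum J K *\<^sub>v v) = - v \<and>
      mat_dsum A B *\<^sub>v (mat_dsum J K *\<^sub>v v) = mat_dsum J K *\<^sub>v (mat_dsum A B *\<^sub>v v)"
    unfolding all_vec_append
    by (simp add: mat_dsum_mult_vec[OF J(1) K(1)] mat_dsum_mult_vec[OF A(1) B(1)] J(2,3) K(2,3)
        uminus_append_vec)
  moreover have "mat_dsum J K \<in> carrier_mat (m + n) (m + n)"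
    using J(1) K(1) by auto
  moreover have "dim_row (mat_dsum A B) = m + n" using A B by simp
  ultimately show ?thesis unfolding commuting_cs_def by metis
qed

text \<open>Two copies of a real space are its complexification, with the pair (v, w) standing for v
  + iw. The doubled \<open>A\<close> is complex-linear there, and \<open>?J\<close> is
  multiplication by i.\<close>

lemma commuting_cs_dsum_self:
  assumes A: "A \<in> carrier_mat n n"
  shows "commuting_cs (mat_dsum A A)"
proof -
  let ?J = "four_block_mat (0\<^sub>m n n) (- 1\<^sub>m n) (1\<^sub>m n) (0\<^sub>m n n) :: real mat"
  have J: "?J *\<^sub>v (v @\<^sub>v w) = - w @\<^sub>v v" if "v \<in> carrier_vec n" "w \<in> carrier_vec n" for v w
  proof -
    have "- 1\<^sub>m n *\<^sub>v w = - w" using that(2) by (subst uminus_mult_mat_vec) auto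
    thus ?thesis using that by (subst four_block_mat_mult_vec[of _ n n _ n _ n]) auto
  qed
  have [simp]: "A *\<^sub>v v \<in> carrier_vec n" for v
    using A unfolding carrier_vec_def by simp
  have "A *\<^sub>v (- w) = - (A *\<^sub>v w)" if "w \<in> carrier_vec n" for w
    using A that by (intro eq_vecI) auto
  hence "\<forall>v \<in> carrier_vec (n + n). ?J *\<^sub>v (?J *\<^sub>v v) = - v \<and>
      mat_dsum A A *\<^sub>v (?J *\<^sub>v v) = ?J *\<^sub>v (mat_dsum A A *\<^sub>v v)"
    unfolding all_vec_append
    by (simp add: mat_dsum_mult_vec[OF A A] J uminus_append_vec)
  moreover have "?J \<in> carrier_mat (n + n) (n + n)"
    by (rule four_block_carrier_mat) auto
  moreover have "dim_row (mat_dsum A A) = n + n" using A by simp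
  ultimately show ?thesis unfolding commuting_cs_def by metis
qed

text \<open>The new hyperplane is the kernel of \<open>\<phi>\<close> together with the whole space
  of \<open>B\<close>, with \<open>J\<close> and \<open>K\<close> acting side by side. Both orders
  are provided because the exceptional pair of blocks may stand anywhere in the list.\<close>

lemma admits_hyperplane_cs_dsum:
  assumes A: "A \<in> carrier_mat m m" "admits_hyperplane_cs A"
    and B: "B \<in> carrier_mat n n" "commuting_cs B"
  shows "admits_hyperplane_cs (mat_dsum A B)" "admits_hyperplane_cs (mat_dsum B A)"
proof -
  obtain J e \<phi> where "hyperplane_cs m A J e \<phi>"
    using A by (auto simp: admits_hyperplane_cs_def)
  note h = hyperplane_csD[OF this]
  note J = h(1) and e = h(2) and \<phi> = h(3)
  obtain K where K: "K \<in> carrier_mat n n" "\<And>v. v \<in> carrier_vec n \<Longrightarrow> K *\<^sub>v (K *\<^sub>v v) = - v"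
    "\<And>v. v \<in> carrier_vec n \<Longrightarrow> B *\<^sub>v (K *\<^sub>v v) = K *\<^sub>v (B *\<^sub>v v)"
    using commuting_csE[OF B(2,1)] by blast
  have [simp]: "A *\<^sub>v v \<in> carrier_vec m" "J *\<^sub>v v \<in> carrier_vec m"
    "B *\<^sub>v v \<in> carrier_vec n" "K *\<^sub>v v \<in> carrier_vec n" for v
    using A B J K unfolding carrier_vec_def by simp_all
  have [simp]: "K *\<^sub>v 0\<^sub>v n = 0\<^sub>v n"
    using K(1) by (intro eq_vecI) auto
  have [simp]: "0\<^sub>v m @\<^sub>v 0\<^sub>v n = (0\<^sub>v (m + n) :: real vec)" "0\<^sub>v n @\<^sub>v 0\<^sub>v m = (0\<^sub>v (n + m) :: real vec)"
    by (auto intro!: eq_vecI)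
  have [simp]: "c \<cdot>\<^sub>v 0\<^sub>v n = 0\<^sub>v n" for c :: real
    by (rule eq_vecI) auto
  have [simp]: "0\<^sub>v n - v = - v" if "v \<in> carrier_vec n" for v :: "real vec"
    using that by (intro eq_vecI) auto
  note dsum = mat_dsum_mult_vec[OF J K(1)] mat_dsum_mult_vec[OF A(1) B(1)]
    mat_dsum_mult_vec[OF K(1) J] mat_dsum_mult_vec[OF B(1) A(1)]
  note app = scalar_prod_append[of _ m _ n] scalar_prod_append[of _ n _ m]
    smult_append_vec minus_append_vec[of _ m _ _ n] minus_append_vec[of _ n _ _ m]
  have dims: "dim_row (mat_dsum A B) = m + n" "dim_row (mat_dsum B A) = n + m"
    using A B by simp_all
  have JK: "mat_dsum J K \<in> carrier_mat (m + n) (m + n)" "mat_dsum K J \<in> carrier_mat (n + m) (n + m)"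
    using J K(1) by (auto intro!: carrier_matI)
  have "hyperplane_cs (m + n) (mat_dsum A B) (mat_dsum J K) (e @\<^sub>v 0\<^sub>v n) (\<phi> @\<^sub>v 0\<^sub>v n)"
    unfolding hyperplane_cs_def all_vec_append
  proof (intro conjI ballI impI)
    fix v w :: "real vec" assume vw [simp]: "v \<in> carrier_vec m" "w \<in> carrier_vec n"
    show "mat_dsum J K *\<^sub>v (mat_dsum J K *\<^sub>v (v @\<^sub>v w)) =
        ((\<phi> @\<^sub>v 0\<^sub>v n) \<bullet> (v @\<^sub>v w)) \<cdot>\<^sub>v (e @\<^sub>v 0\<^sub>v n) - (v @\<^sub>v w)"
      by (simp add: dsum app h K)
    show "(\<phi> @\<^sub>v 0\<^sub>v n) \<bullet> (mat_dsum J K *\<^sub>v (v @\<^sub>v w)) = 0"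
      "(\<phi> @\<^sub>v 0\<^sub>v n) \<bullet> (mat_dsum A B *\<^sub>v (v @\<^sub>v w)) = 0"
      by (simp_all add: dsum app h)
    assume "(\<phi> @\<^sub>v 0\<^sub>v n) \<bullet> (v @\<^sub>v w) = 0"
    thus "mat_dsum A B *\<^sub>v (mat_dsum J K *\<^sub>v (v @\<^sub>v w)) = mat_dsum J K *\<^sub>v (mat_dsum A B *\<^sub>v (v @\<^sub>v w))"
      by (simp add: dsum app h K)
  qed (simp_all add: dsum app h JK)
  thus "admits_hyperplane_cs (mat_dsum A B)"
    unfolding admits_hyperplane_cs_def dims by blast
  have "hyperplane_cs (n + m) (mat_dsum B A) (mat_dsum K J) (0\<^sub>v n @\<^sub>v e) (0\<^sub>v n @\<^sub>v \<phi>)"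
    unfolding hyperplane_cs_def all_vec_append
  proof (intro conjI ballI impI)
    fix v w :: "real vec" assume vw [simp]: "v \<in> carrier_vec n" "w \<in> carrier_vec m"
    show "mat_dsum K J *\<^sub>v (mat_dsum K J *\<^sub>v (v @\<^sub>v w)) =
        ((0\<^sub>v n @\<^sub>v \<phi>) \<bullet> (v @\<^sub>v w)) \<cdot>\<^sub>v (0\<^sub>v n @\<^sub>v e) - (v @\<^sub>v w)"
      by (simp add: dsum app h K)
    show "(0\<^sub>v n @\<^sub>v \<phi>) \<bullet> (mat_dsum K J *\<^sub>v (v @\<^sub>v w)) = 0"
      "(0\<^sub>v n @\<^sub>v \<phi>) \<bullet> (mat_dsum B A *\<^sub>v (v @\<^sub>v w)) = 0"
      by (simp_all add: dsum app h)
    assume "(0\<^sub>v n @\<^sub>v \<phi>) \<bullet> (v @\<^sub>v w) = 0"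
    thus "mat_dsum B A *\<^sub>v (mat_dsum K J *\<^sub>v (v @\<^sub>v w)) = mat_dsum K J *\<^sub>v (mat_dsum B A *\<^sub>v (v @\<^sub>v w))"
      by (simp add: dsum app h K)
  qed (simp_all add: dsum app h JK)
  thus "admits_hyperplane_cs (mat_dsum B A)"
    unfolding admits_hyperplane_cs_def dims by blast
qed

section \<open>Jordan blocks of suitable multiplicities\<close>

lemma diag_block_mat_append_dsum:
  "diag_block_mat (xs @ ys) = mat_dsum (diag_block_mat xs) (diag_block_mat ys)"
  by (simp add: diag_block_mat_append mat_dsum_def Let_def)

lemma diag_block_mat_carrier:
  assumes "Ball (set xs) square_mat"
  shows "diag_block_mat xs \<in> carrier_mat (sum_list (map dim_row xs)) (sum_list (map dim_row xs))"
  using diag_block_mat_square[OF assms] by (auto simp: dim_diag_block_mat)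

text \<open>Shifts and signed permutations have at most one nonzero entry per row, which this
  evaluates. A row with \<open>c i = 0\<close> may have \<open>g i\<close> out of range: the
  unspecified entry is multiplied by zero.\<close>

lemma mult_mat_vec_single_entry:
  assumes v: "v \<in> carrier_vec n" and g: "\<And>i. i < m \<Longrightarrow> c i \<noteq> 0 \<Longrightarrow> g i < n"
  shows "mat m n (\<lambda>(i, j). if j = g i then c i else (0 :: real)) *\<^sub>v v = vec m (\<lambda>i. c i * v $ g i)"
proof (rule eq_vecI)
  fix i assume "i < dim_vec (vec m (\<lambda>i. c i * v $ g i))"
  hence i: "i < m" by simp
  have "(mat m n (\<lambda>(i, j). if j = g i then c i else 0) *\<^sub>v v) $ i
      = (\<Sum>j = 0..<n. (if j = g i then c i else 0) * v $ j)"
    using i v by (auto simp: scalar_prod_def intro!: sum.cong)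
  also have "\<dots> = (\<Sum>j = 0..<n. if j = g i then c i * v $ j else 0)"
    by (rule sum.cong) auto
  also have "\<dots> = c i * v $ g i" using g[OF i] by (subst sum.delta) auto
  finally show "(mat m n (\<lambda>(i, j). if j = g i then c i else 0) *\<^sub>v v) $ i
      = vec m (\<lambda>i. c i * v $ g i) $ i" using i by simp
qed auto

text \<open>
  Removing the generator of the larger block leaves two blocks of size \<open>m\<close>, which \<open>J\<close> exchanges up to
  sign.
\<close>

lemma admits_hyperplane_cs_consecutive_blocks:
  "admits_hyperplane_cs (diag_block_mat [nilpotent_jordan_block (Suc m), nilpotent_jordan_block m])"
    (is "admits_hyperplane_cs ?A")
proof -
  let ?d = "Suc (2 * m)"
  \<comment> \<open>Coordinate 0 is the generator of the larger block, 1 to \<open>m\<close> are the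
    rest of it, and \<open>m + 1\<close> to \<open>2 * m\<close> are the smaller block.
    \<open>J\<close> sends a pair (v, w) of the last two groups to (-w, v).\<close>
  define J :: "real mat" where "J = mat ?d ?d (\<lambda>(i, j).
    if j = (if i = 0 then 0 else if i \<le> m then i + m else i - m)
    then (if i = 0 then 0 else if i \<le> m then -1 else 1) else 0)"
  define A where "A = ?A"
  \<comment> \<open>Rows 0 and \<open>Suc m\<close> are the first rows of the two blocks and vanish;
    the value \<open>0 - 1 = 0\<close> in row 0 is therefore harmless.\<close>
  have A: "A = mat ?d ?d (\<lambda>(i, j). if j = i - 1 then (if i = 0 \<or> i = Suc m then 0 else 1) else 0)"
    unfolding A_def by (rule eq_matI) (auto simp: nilpotent_jordan_block_def)
  have Av: "A *\<^sub>v v = vec ?d (\<lambda>i. (if i = 0 \<or> i = Suc m then 0 else 1) * v $ (i - 1))"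
    if "v \<in> carrier_vec ?d" for v
    unfolding A by (rule mult_mat_vec_single_entry[OF that]) auto
  have Jv: "J *\<^sub>v v = vec ?d (\<lambda>i. (if i = 0 then 0 else if i \<le> m then -1 else 1)
      * v $ (if i = 0 then 0 else if i \<le> m then i + m else i - m))"
    if "v \<in> carrier_vec ?d" for v
    unfolding J_def by (rule mult_mat_vec_single_entry[OF that]) auto
  have e: "unit_vec ?d 0 \<bullet> v = v $ 0" if "v \<in> carrier_vec ?d" for v :: "real vec"
    using that by simp
  have "hyperplane_cs ?d A J (unit_vec ?d 0) (unit_vec ?d 0)"
    unfolding hyperplane_cs_def
  proof (intro conjI ballI impI)
    fix v :: "real vec" assume v: "v \<in> carrier_vec ?d"
    show "J *\<^sub>v (J *\<^sub>v v) = (unit_vec ?d 0 \<bullet> v) \<cdot>\<^sub>v unit_vec ?d 0 - v"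
      using v by (intro eq_vecI) (auto simp: Jv simp del: index_mult_mat_vec)
    show "unit_vec ?d 0 \<bullet> (J *\<^sub>v v) = 0" "unit_vec ?d 0 \<bullet> (A *\<^sub>v v) = 0"
      using v by (simp_all add: Jv Av e)
    assume "unit_vec ?d 0 \<bullet> v = 0"
    \<comment> \<open>The two sides can differ only in row \<open>Suc m\<close>, where the right one
      has the entry \<open>v $ 0\<close>.\<close>
    hence "v $ 0 = 0" using v by simp
    thus "A *\<^sub>v (J *\<^sub>v v) = J *\<^sub>v (A *\<^sub>v v)"
      using v by (simp add: Jv Av) (rule eq_vecI; auto)
  qed (auto simp: J_def Jv intro!: eq_vecI)
  moreover have "dim_row A = ?d" unfolding A by simp
  ultimately show ?thesis unfolding A_def admits_hyperplane_cs_def by metis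
qed

lemma commuting_cs_diag_block_append:
  assumes "Ball (set xs) square_mat" "commuting_cs (diag_block_mat xs)"
    and "Ball (set ys) square_mat" "commuting_cs (diag_block_mat ys)"
  shows "commuting_cs (diag_block_mat (xs @ ys))"
  unfolding diag_block_mat_append_dsum
  by (rule commuting_cs_dsum[OF diag_block_mat_carrier assms(2) diag_block_mat_carrier assms(4)])
    (use assms in auto)

lemma admits_hyperplane_cs_diag_block_append:
  assumes "Ball (set xs) square_mat" "admits_hyperplane_cs (diag_block_mat xs)"
    and "Ball (set ys) square_mat" "commuting_cs (diag_block_mat ys)"
  shows "admits_hyperplane_cs (diag_block_mat (xs @ ys))"
    and "admits_hyperplane_cs (diag_block_mat (ys @ xs))"
  unfolding diag_block_mat_append_dsum
  by (rule admits_hyperplane_cs_dsum[OF diag_block_mat_carrier assms(2) diag_block_mat_carrier assms(4)];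
      use assms in auto)+

lemma commuting_cs_Nil: "commuting_cs (diag_block_mat [])"
  unfolding commuting_cs_def
  by (intro bexI[of _ "0\<^sub>m 0 0"] ballI conjI eq_vecI) auto

text \<open>Equal blocks are grouped in pairs, and each pair is a complexification.\<close>

lemma commuting_cs_replicate:
  assumes "square_mat X" "even p"
  shows "commuting_cs (diag_block_mat (replicate p X))"
proof -
  obtain q where p: "p = 2 * q" using assms(2) by (rule evenE)
  have X: "X \<in> carrier_mat (dim_row X) (dim_row X)" using assms(1) by auto
  have XX: "commuting_cs (diag_block_mat [X, X])"
    using commuting_cs_dsum_self[OF X] diag_block_mat_append_dsum[of "[X]" "[X]"]
    by (simp del: diag_block_mat.simps)
  show ?thesis unfolding p
  proof (induction q)
    case 0
    show ?case using commuting_cs_Nil by simp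
  next
    case (Suc q)
    have "replicate (2 * Suc q) X = [X, X] @ replicate (2 * q) X" by simp
    thus ?case
      using commuting_cs_diag_block_append[OF _ XX _ Suc] assms(1)
      by (simp del: diag_block_mat.simps)
  qed
qed

lemma commuting_cs_concat:
  assumes "\<forall>i \<in> set is. Ball (set (f i)) square_mat \<and> commuting_cs (diag_block_mat (f i))"
  shows "commuting_cs (diag_block_mat (concat (map f is)))"
  using assms
proof (induction "is")
  case Nil
  show ?case using commuting_cs_Nil by simp
next
  case (Cons i "is")
  show ?case unfolding list.map concat.simps
    by (rule commuting_cs_diag_block_append) (use Cons in \<open>auto simp del: square_mat.simps\<close>)
qed

lemma commuting_cs_zero_mat:
  assumes "even t"
  shows "commuting_cs (0\<^sub>m t t)"
proof -
  obtain s where t: "t = 2 * s" using assms by (rule evenE)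
  have "mat_dsum (0\<^sub>m s s) (0\<^sub>m s s) = 0\<^sub>m t t"
    by (rule eq_matI) (auto simp: mat_dsum_def t)
  thus ?thesis using commuting_cs_dsum_self[of "0\<^sub>m s s" s] by simp
qed

lemma dim_nilpotent_jordan_block [simp]:
  "dim_row (nilpotent_jordan_block n) = n" "dim_col (nilpotent_jordan_block n) = n"
  by (simp_all add: nilpotent_jordan_block_def)

text \<open>The zero part is \<open>t\<close> blocks of size one. For odd \<open>t\<close>, one of
  them is set aside for the exceptional pair and an even number remains.\<close>

lemma diag_block_mat_zero_split:
  assumes "odd t"
  shows "diag_block_mat (xs @ [0\<^sub>m t t]) =
    diag_block_mat (xs @ [nilpotent_jordan_block (Suc 0), 0\<^sub>m (t - 1) (t - 1)])"
proof -
  have "diag_block_mat [nilpotent_jordan_block (Suc 0), 0\<^sub>m (t - 1) (t - 1)] = 0\<^sub>m t t"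
    by (rule eq_matI) (use odd_pos[OF assms] in \<open>auto simp: nilpotent_jordan_block_def\<close>)
  thus ?thesis by (simp add: diag_block_mat_append_dsum del: diag_block_mat.simps)
qed

text \<open>In each case one pair of blocks of consecutive sizes is singled out, of sizes (1, 0),
  (2, 1) or (\<open>ns l + 1\<close>, \<open>ns l\<close>); it carries the hyperplane. All other
  blocks occur in even numbers.\<close>

lemma admits_hyperplane_cs_jordan_blocks:
  fixes ns ps :: "nat \<Rightarrow> nat"
  assumes k: "k \<ge> 1"
    and types: "(odd t \<and> (\<forall>i \<in> {1..k}. even (ps i))) \<or>
      (odd t \<and> (\<forall>i \<in> {1..k - 1}. even (ps i)) \<and> ns k = 2 \<and> odd (ps k)) \<or>
      (even t \<and> k \<ge> 2 \<and>
        (\<exists>l \<in> {2..k}. ns (l - 1) = ns l + 1 \<and> odd (ps (l - 1)) \<and> odd (ps l) \<and>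
          (\<forall>i \<in> {1..k} - {l - 1, l}. even (ps i))))"
  shows "admits_hyperplane_cs (diag_block_mat
    (concat (map (\<lambda>i. replicate (ps i) (nilpotent_jordan_block (ns i))) [1..<Suc k]) @ [0\<^sub>m t t]))"
proof -
  let ?N = "nilpotent_jordan_block"
  let ?f = "\<lambda>i. replicate (ps i) (?N (ns i))"
  have sq: "Ball (set (concat (map ?f is))) square_mat" "Ball (set (replicate p (?N n))) square_mat"
    "Ball (set [?N n, ?N n']) square_mat" "Ball (set [0\<^sub>m p p :: real mat]) square_mat"
    for "is" p n n' by auto
  have C: "commuting_cs (diag_block_mat (concat (map ?f is)))" if "\<forall>i \<in> set is. even (ps i)" for "is"
    by (rule commuting_cs_concat)
      (use that sq(2) in \<open>auto intro!: commuting_cs_replicate simp del: diag_block_mat.simps\<close>)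
  have R: "commuting_cs (diag_block_mat (replicate p (?N n)))" if "even p" for p n
    by (rule commuting_cs_replicate) (use that in auto)
  have Z: "commuting_cs (diag_block_mat [0\<^sub>m s s])" if "even s" for s
    using commuting_cs_zero_mat[OF that] by simp
  note H = admits_hyperplane_cs_consecutive_blocks
  note app = admits_hyperplane_cs_diag_block_append
  consider (i) "odd t" "\<forall>i \<in> {1..k}. even (ps i)"
    | (ii) "odd t" "\<forall>i \<in> {1..k - 1}. even (ps i)" "ns k = 2" "odd (ps k)"
    | (iii) l where "even t" "l \<in> {2..k}" "ns (l - 1) = ns l + 1" "odd (ps (l - 1))" "odd (ps l)"
      "\<forall>i \<in> {1..k} - {l - 1, l}. even (ps i)"
    using types by auto
  thus ?thesis
  proof cases
    case i
    \<comment> \<open>The partner of the block of size one is the empty block, whose insertion does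
      not change the matrix.\<close>
    have "diag_block_mat [?N (Suc 0), ?N 0, 0\<^sub>m (t - 1) (t - 1)]
        = diag_block_mat [?N (Suc 0), 0\<^sub>m (t - 1) (t - 1)]"
      by (rule eq_matI) (auto simp: nilpotent_jordan_block_def)
    hence eq: "diag_block_mat (xs @ [?N (Suc 0), 0\<^sub>m (t - 1) (t - 1)])
        = diag_block_mat (xs @ [?N (Suc 0), ?N 0] @ [0\<^sub>m (t - 1) (t - 1)])" for xs
      by (simp add: diag_block_mat_append_dsum[of xs] del: diag_block_mat.simps)
    show ?thesis unfolding diag_block_mat_zero_split[OF i(1)] eq
      by (intro app(2)[of _ "concat _"] app(1)[of "[_, _]"] sq C H Z) (use i sq in auto)
  next
    case ii
    have "[1..<Suc k] = [1..<k] @ [k]" using k by simp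
    moreover obtain p where p: "ps k = Suc p" using odd_pos[OF ii(4)] by (cases "ps k") auto
    \<comment> \<open>The last block of size 2 is paired with the block of size one from the zero
      part; the other \<open>p\<close> blocks are even in number.\<close>
    moreover have "replicate (Suc p) (?N 2) = replicate p (?N 2) @ [?N 2]"
      by (simp add: replicate_append_same)
    ultimately have eq: "concat (map ?f [1..<Suc k]) = concat (map ?f [1..<k]) @
        replicate p (?N 2) @ [?N 2]"
      using ii(3) by simp
    have "admits_hyperplane_cs (diag_block_mat [?N 2, ?N (Suc 0)])"
      using H[of "Suc 0"] unfolding numeral_2_eq_2 .
    hence "admits_hyperplane_cs (diag_block_mat (concat (map ?f [1..<k]) @ replicate p (?N 2) @
        [?N 2, ?N (Suc 0)] @ [0\<^sub>m (t - 1) (t - 1)]))"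
      by (intro app(2)[of _ "concat _"] app(2)[of _ "replicate _ _"] app(1)[of "[_, _]"] sq C Z R)
        (use ii p sq in auto)
    thus ?thesis unfolding diag_block_mat_zero_split[OF ii(1)] eq by simp
  next
    case iii
    have l: "1 \<le> l - 1" "l - 1 < Suc k" "l < Suc k" "Suc (l - 1) = l" using iii(2) by auto
    have "[1..<Suc k] = [1..<l - 1] @ [l - 1..<Suc k]"
      using upt_add_eq_append[OF l(1), of "Suc k - (l - 1)"] l(2) by (simp del: upt_Suc)
    also have "[l - 1..<Suc k] = [l - 1] @ [l] @ [Suc l..<Suc k]"
      using upt_conv_Cons[OF l(2)] upt_conv_Cons[OF l(3)] l(4) by simp
    finally have "[1..<Suc k] = [1..<l - 1] @ [l - 1] @ [l] @ [Suc l..<Suc k]" .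
    moreover obtain p where p: "ps (l - 1) = Suc p" using odd_pos[OF iii(4)] by (cases "ps (l - 1)") auto
    moreover obtain q where q: "ps l = Suc q" using odd_pos[OF iii(5)] by (cases "ps l") auto
    \<comment> \<open>The last block of size \<open>Suc (ns l)\<close> and the first of size
      \<open>ns l\<close> are neighbours in the list and form the exceptional pair.\<close>
    moreover have "replicate (Suc p) (?N (Suc (ns l))) = replicate p (?N (Suc (ns l))) @ [?N (Suc (ns l))]"
      by (simp add: replicate_append_same)
    ultimately have eq: "concat (map ?f [1..<Suc k]) = concat (map ?f [1..<l - 1]) @
        replicate p (?N (Suc (ns l))) @ [?N (Suc (ns l)), ?N (ns l)] @ replicate q (?N (ns l)) @
        concat (map ?f [Suc l..<Suc k])"
      using iii(3) by simp
    have "set [1..<l - 1] \<subseteq> {1..k} - {l - 1, l}" "set [Suc l..<Suc k] \<subseteq> {1..k} - {l - 1, l}"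
      using l by auto
    hence "\<forall>i \<in> set [1..<l - 1]. even (ps i)" "\<forall>i \<in> set [Suc l..<Suc k]. even (ps i)"
      using iii(6) by blast+
    moreover have "even p" "even q" using iii(4,5) p q by auto
    ultimately have "admits_hyperplane_cs (diag_block_mat (concat (map ?f [1..<l - 1]) @
        replicate p (?N (Suc (ns l))) @ [?N (Suc (ns l)), ?N (ns l)] @ replicate q (?N (ns l)) @
        concat (map ?f [Suc l..<Suc k]) @ [0\<^sub>m t t]))"
      by (intro app(2)[of _ "concat _"] app(2)[of _ "replicate _ _"] app(1)[of "[_, _]"] H
          commuting_cs_diag_block_append sq C Z R)
        (use iii(1) sq in auto)
    thus ?thesis unfolding eq by simp
  qed
qed

section \<open>The hyperplane of a complex structure\<close>

lemma real_functional_scalar_prod: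
  fixes h :: "real vec \<Rightarrow> real"
  assumes add: "\<And>v w. v \<in> carrier_vec d \<Longrightarrow> w \<in> carrier_vec d \<Longrightarrow> h (v + w) = h v + h w"
    and smult: "\<And>c v. v \<in> carrier_vec d \<Longrightarrow> h (c \<cdot>\<^sub>v v) = c * h v"
  shows "\<exists>\<phi> \<in> carrier_vec d. \<forall>v \<in> carrier_vec d. h v = \<phi> \<bullet> v"
proof (intro bexI ballI)
  let ?\<phi> = "vec d (\<lambda>i. h (unit_vec d i))"
  \<comment> \<open>Induction on the number \<open>k\<close> of leading coordinates that may be
    nonzero; the step strips off coordinate \<open>k\<close>.\<close>
  have *: "h v = (\<Sum>i<k. h (unit_vec d i) * v $ i)"
    if "k \<le> d" "v \<in> carrier_vec d" "\<And>i. k \<le> i \<Longrightarrow> i < d \<Longrightarrow> v $ i = 0" for k v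
    using that
  proof (induction k arbitrary: v)
    case 0
    hence "v = 0 \<cdot>\<^sub>v v" by (intro eq_vecI) auto
    thus ?case using smult[OF 0(2), of 0] by simp
  next
    case (Suc k)
    define w where "w = vec d (\<lambda>i. if i = k then 0 else v $ i)"
    have w: "w \<in> carrier_vec d" by (simp add: w_def)
    have v: "v = w + v $ k \<cdot>\<^sub>v unit_vec d k"
      using Suc.prems by (intro eq_vecI) (auto simp: w_def)
    have "h w = (\<Sum>i<k. h (unit_vec d i) * w $ i)"
      using Suc.prems by (intro Suc.IH) (auto simp: w_def le_Suc_eq)
    also have "\<dots> = (\<Sum>i<k. h (unit_vec d i) * v $ i)"
      using Suc.prems by (intro sum.cong) (auto simp: w_def)
    finally show ?case
      using add[OF w, of "v $ k \<cdot>\<^sub>v unit_vec d k"] smult[of "unit_vec d k" "v $ k"] v by simp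
  qed
  show "h v = ?\<phi> \<bullet> v" if v: "v \<in> carrier_vec d" for v
    using *[OF le_refl v] v by (simp add: scalar_prod_def atLeast0LessThan)
qed auto

lemma real_linear_mult_mat_vec:
  fixes T :: "real vec \<Rightarrow> real vec"
  assumes T: "\<And>v. v \<in> carrier_vec d \<Longrightarrow> T v \<in> carrier_vec m"
    and add: "\<And>v w. v \<in> carrier_vec d \<Longrightarrow> w \<in> carrier_vec d \<Longrightarrow> T (v + w) = T v + T w"
    and smult: "\<And>c v. v \<in> carrier_vec d \<Longrightarrow> T (c \<cdot>\<^sub>v v) = c \<cdot>\<^sub>v T v"
  shows "\<exists>J \<in> carrier_mat m d. \<forall>v \<in> carrier_vec d. T v = J *\<^sub>v v"
proof -
  have "\<exists>\<phi> \<in> carrier_vec d. \<forall>v \<in> carrier_vec d. T v $ r = \<phi> \<bullet> v" if "r < m" for r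
    by (intro real_functional_scalar_prod)
      (use that in \<open>simp_all add: add smult T[THEN carrier_vecD]\<close>)
  then obtain \<phi> where \<phi>: "\<And>r. r < m \<Longrightarrow> \<phi> r \<in> carrier_vec d"
    "\<And>r v. r < m \<Longrightarrow> v \<in> carrier_vec d \<Longrightarrow> T v $ r = \<phi> r \<bullet> v" by metis
  define J where "J = mat m d (\<lambda>(r, c). \<phi> r $ c)"
  have row: "row J r = \<phi> r" if "r < m" for r
    using \<phi>(1)[OF that] that by (intro eq_vecI) (auto simp: J_def)
  have J: "J \<in> carrier_mat m d" by (simp add: J_def)
  have "T v = J *\<^sub>v v" if v: "v \<in> carrier_vec d" for v
    using T[OF v] v J by (intro eq_vecI) (auto simp: \<phi>(2) row)
  thus ?thesis using J by blast
qed

text \<open>On the ideal, \<open>\<phi>\<close> is the \<open>e\<^sub>0\<close>-component of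
  \<open>j\<close> and \<open>J\<close> the remaining one, so the kernel of \<open>\<phi>\<close>
  consists of the vectors that \<open>j\<close> keeps in the ideal. Integrability at
  \<open>e\<^sub>0\<close> and such a vector gives the last two claims.\<close>

lemma hyperplane_of_complex_structure:
  assumes M: "M \<in> carrier_mat d d" and cs: "complex_structure (almost_abelian M) j"
  obtains J \<phi> where "J \<in> carrier_mat d d" "\<phi> \<in> carrier_vec d"
    and "\<And>w. w \<in> carrier_vec d \<Longrightarrow> \<phi> \<bullet> w = 0 \<Longrightarrow> \<phi> \<bullet> (J *\<^sub>v w) = 0"
    and "\<And>w. w \<in> carrier_vec d \<Longrightarrow> \<phi> \<bullet> w = 0 \<Longrightarrow> J *\<^sub>v (J *\<^sub>v w) = - w"
    and "\<And>w. w \<in> carrier_vec d \<Longrightarrow> \<phi> \<bullet> w = 0 \<Longrightarrow> \<phi> \<bullet> (M *\<^sub>v w) = 0"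
    and "\<And>w. w \<in> carrier_vec d \<Longrightarrow> \<phi> \<bullet> w = 0 \<Longrightarrow> M *\<^sub>v (J *\<^sub>v w) = J *\<^sub>v (M *\<^sub>v w)"
proof -
  let ?L = "almost_abelian M"
  have [simp]: "dim_row M = d" using M by simp
  have j_add: "j ((a, v) \<oplus>\<^bsub>?L\<^esub> (b, w)) = j (a, v) \<oplus>\<^bsub>?L\<^esub> j (b, w)"
    and j_smult: "j (c \<odot>\<^bsub>?L\<^esub> (a, v)) = c \<odot>\<^bsub>?L\<^esub> j (a, v)"
    and j_closed: "j (a, v) \<in> UNIV \<times> carrier_vec d"
    if "v \<in> carrier_vec d" "w \<in> carrier_vec d" for a v b w c
    using cs that unfolding complex_structure_def LinearCombinations.module_hom_def by (auto simp: Pi_def)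
  have fst_j: "fst (j (0, v + w)) = fst (j (0, v)) + fst (j (0, w))"
    and snd_j: "snd (j (0, v + w)) = snd (j (0, v)) + snd (j (0, w))"
    and fst_js: "fst (j (0, c \<cdot>\<^sub>v v)) = c * fst (j (0, v))"
    and snd_js: "snd (j (0, c \<cdot>\<^sub>v v)) = c \<cdot>\<^sub>v snd (j (0, v))"
    if "v \<in> carrier_vec d" "w \<in> carrier_vec d" for v w c
    using j_add[OF that, of 0 0] j_smult[OF that, of c 0]
    by (cases "j (0, v)"; cases "j (0, w)"; simp)+
  obtain \<phi> where \<phi>: "\<phi> \<in> carrier_vec d" "\<And>v. v \<in> carrier_vec d \<Longrightarrow> fst (j (0, v)) = \<phi> \<bullet> v"
    using real_functional_scalar_prod[of d "\<lambda>v. fst (j (0, v))"] fst_j fst_js by metis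
  have "snd (j (0, v)) \<in> carrier_vec d" if "v \<in> carrier_vec d" for v
    using j_closed[OF that that, of 0] by auto
  then obtain J where J: "J \<in> carrier_mat d d" "\<And>v. v \<in> carrier_vec d \<Longrightarrow> snd (j (0, v)) = J *\<^sub>v v"
    using real_linear_mult_mat_vec[of d "\<lambda>v. snd (j (0, v))" d] snd_j snd_js by metis
  have j0: "j (0, v) = (\<phi> \<bullet> v, J *\<^sub>v v)" if "v \<in> carrier_vec d" for v
    using \<phi>(2)[OF that] J(2)[OF that] by (metis prod.collapse)
  \<comment> \<open>Only \<open>\<alpha>\<close> survives in the brackets below, because
    \<open>f\<close> commutes with the ideal.\<close>
  obtain \<alpha> f where j1: "j (1, 0\<^sub>v d) = (\<alpha>, f)" and f: "f \<in> carrier_vec d"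
    using j_closed[of "0\<^sub>v d" "0\<^sub>v d" 1] by auto
  have [simp]: "J *\<^sub>v v \<in> carrier_vec d" "M *\<^sub>v v \<in> carrier_vec d" for v
    using J M unfolding carrier_vec_def by simp_all
  have [simp]: "dim_row J = d" "dim_vec \<phi> = d" using J \<phi> by simp_all
  note lin = mult_add_distrib_mat_vec[OF J(1)] mult_minus_distrib_mat_vec[OF J(1)]
    mult_mat_vec[OF J(1)] scalar_prod_add_distrib[OF \<phi>(1)] scalar_prod_smult_distrib[OF \<phi>(1)]
    scalar_prod_minus_distrib[OF \<phi>(1)]
  have jj: "\<phi> \<bullet> (J *\<^sub>v w) = 0 \<and> J *\<^sub>v (J *\<^sub>v w) = - w"
    if w: "w \<in> carrier_vec d" "\<phi> \<bullet> w = 0" for w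
  proof -
    have "j (j (0, w)) = (0, - w)"
      using cs w(1) almost_abelian_uminus[OF M w(1), of 0] unfolding complex_structure_def by simp
    thus ?thesis using w by (simp add: j0)
  qed
  have N: "(\<lbrakk>x, y\<rbrakk>\<^bsub>?L\<^esub> \<oplus>\<^bsub>?L\<^esub> j (\<lbrakk>j x, y\<rbrakk>\<^bsub>?L\<^esub> \<oplus>\<^bsub>?L\<^esub> \<lbrakk>x, j y\<rbrakk>\<^bsub>?L\<^esub>)) \<ominus>\<^bsub>?L\<^esub> \<lbrakk>j x, j y\<rbrakk>\<^bsub>?L\<^esub> = \<zero>\<^bsub>?L\<^esub>"
    if "x \<in> carrier ?L" "y \<in> carrier ?L" for x y
    using cs that unfolding complex_structure_def by blast
  \<comment> \<open>The integrability condition at \<open>e\<^sub>0\<close> and \<open>w\<close>,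
    split into its two components.\<close>
  have nij: "\<alpha> * (\<phi> \<bullet> (M *\<^sub>v w)) + \<phi> \<bullet> (M *\<^sub>v (J *\<^sub>v w)) = 0"
    "M *\<^sub>v w + (\<alpha> \<cdot>\<^sub>v (J *\<^sub>v (M *\<^sub>v w)) + J *\<^sub>v (M *\<^sub>v (J *\<^sub>v w))) - \<alpha> \<cdot>\<^sub>v (M *\<^sub>v (J *\<^sub>v w)) = 0\<^sub>v d"
    if w: "w \<in> carrier_vec d" "\<phi> \<bullet> w = 0" for w
  proof -
    let ?x = "(1, 0\<^sub>v d)" and ?y = "(0, w)"
    have M0: "M *\<^sub>v 0\<^sub>v d = 0\<^sub>v d" using M by (intro eq_vecI) auto
    have z: "0 \<cdot>\<^sub>v v = 0\<^sub>v d" "v - 0\<^sub>v d = v" if "v \<in> carrier_vec d" for v :: "real vec"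
      using that by (auto intro!: eq_vecI)
    have br: "\<lbrakk>?x, ?y\<rbrakk>\<^bsub>?L\<^esub> = (0, M *\<^sub>v w)" "\<lbrakk>j ?x, ?y\<rbrakk>\<^bsub>?L\<^esub> = (0, \<alpha> \<cdot>\<^sub>v (M *\<^sub>v w))"
      "\<lbrakk>?x, j ?y\<rbrakk>\<^bsub>?L\<^esub> = (0, M *\<^sub>v (J *\<^sub>v w))" "\<lbrakk>j ?x, j ?y\<rbrakk>\<^bsub>?L\<^esub> = (0, \<alpha> \<cdot>\<^sub>v (M *\<^sub>v (J *\<^sub>v w)))"
      using w f by (simp_all add: j1 j0 M0 z)
    have "(\<lbrakk>?x, ?y\<rbrakk>\<^bsub>?L\<^esub> \<oplus>\<^bsub>?L\<^esub> j (\<lbrakk>j ?x, ?y\<rbrakk>\<^bsub>?L\<^esub> \<oplus>\<^bsub>?L\<^esub> \<lbrakk>?x, j ?y\<rbrakk>\<^bsub>?L\<^esub>)) \<ominus>\<^bsub>?L\<^esub> \<lbrakk>j ?x, j ?y\<rbrakk>\<^bsub>?L\<^esub>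
        = \<zero>\<^bsub>?L\<^esub>"
      by (rule N) (use w(1) in simp_all)
    thus "\<alpha> * (\<phi> \<bullet> (M *\<^sub>v w)) + \<phi> \<bullet> (M *\<^sub>v (J *\<^sub>v w)) = 0"
      "M *\<^sub>v w + (\<alpha> \<cdot>\<^sub>v (J *\<^sub>v (M *\<^sub>v w)) + J *\<^sub>v (M *\<^sub>v (J *\<^sub>v w))) - \<alpha> \<cdot>\<^sub>v (M *\<^sub>v (J *\<^sub>v w)) = 0\<^sub>v d"
      unfolding br by (simp_all add: j0 lin almost_abelian_minus[OF M])
  qed
  have main: "\<phi> \<bullet> (M *\<^sub>v w) = 0 \<and> M *\<^sub>v (J *\<^sub>v w) = J *\<^sub>v (M *\<^sub>v w)"
    if w: "w \<in> carrier_vec d" "\<phi> \<bullet> w = 0" for w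
  proof -
    define p q where "p = M *\<^sub>v w" and "q = M *\<^sub>v (J *\<^sub>v w)"
    have pq [simp]: "p \<in> carrier_vec d" "q \<in> carrier_vec d" by (simp_all add: p_def q_def)
    have dims: "dim_vec p = d" "dim_vec q = d" by simp_all
    \<comment> \<open>\<open>- p\<close> is written as a difference because \<open>lin\<close>
      covers sums, differences and multiples, but not negation.\<close>
    have "M *\<^sub>v (J *\<^sub>v (J *\<^sub>v w)) = 0 \<cdot>\<^sub>v p - p" "M *\<^sub>v (- w) = - p"
      using jj[OF w] w M by (auto simp: p_def intro!: eq_vecI)
    hence "M *\<^sub>v (J *\<^sub>v (J *\<^sub>v w)) = 0 \<cdot>\<^sub>v p - p" by simp
    \<comment> \<open>The first equation is used at \<open>J *\<^sub>v w\<close> as well as at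
      \<open>w\<close>; eliminating \<open>\<phi> \<bullet> q\<close> leaves a positive multiple of
      \<open>\<phi> \<bullet> p\<close>.\<close>
    hence "\<alpha> * (\<phi> \<bullet> q) - \<phi> \<bullet> p = 0"
      using nij(1)[of "J *\<^sub>v w"] jj[OF w] by (simp add: q_def[symmetric] lin)
    moreover have 1: "\<alpha> * (\<phi> \<bullet> p) + \<phi> \<bullet> q = 0" using nij(1)[OF w] by (simp add: p_def q_def)
    moreover have "\<phi> \<bullet> q = - \<alpha> * (\<phi> \<bullet> p)" using 1 by simp
    ultimately have "(1 + \<alpha> * \<alpha>) * (\<phi> \<bullet> p) = 0" by (simp add: algebra_simps)
    moreover have "1 + \<alpha> * \<alpha> \<noteq> 0" using zero_le_square[of \<alpha>] by linarith
    ultimately have \<phi>p: "\<phi> \<bullet> p = 0" by simp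
    hence \<phi>q: "\<phi> \<bullet> q = 0" using 1 by simp
    \<comment> \<open>\<open>c\<close> is the commutator of \<open>J\<close> and \<open>M\<close> at
      \<open>w\<close>. The second equation makes it an eigenvector-like vector with real factor
      \<open>\<alpha>\<close>, while \<open>J\<close> squares to -1 on it, which forces
      \<open>c\<close> to vanish.\<close>
    define c where "c = J *\<^sub>v p - q"
    have c [simp]: "c \<in> carrier_vec d" by (simp add: c_def)
    have \<phi>c: "\<phi> \<bullet> c = 0" using jj[OF pq(1) \<phi>p] \<phi>q by (simp add: c_def lin)
    have eq: "p + (\<alpha> \<cdot>\<^sub>v (J *\<^sub>v p) + J *\<^sub>v q) - \<alpha> \<cdot>\<^sub>v q = 0\<^sub>v d"
      using nij(2)[OF w] by (simp add: p_def q_def)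
    have Jc: "J *\<^sub>v c = \<alpha> \<cdot>\<^sub>v c"
    proof (rule eq_vecI)
      fix i assume "i < dim_vec (\<alpha> \<cdot>\<^sub>v c)"
      hence i: "i < d" by (simp add: carrier_vecD[OF c])
      have "J *\<^sub>v c = - p - J *\<^sub>v q" using jj[OF pq(1) \<phi>p] by (simp add: c_def lin)
      moreover have "(p + (\<alpha> \<cdot>\<^sub>v (J *\<^sub>v p) + J *\<^sub>v q) - \<alpha> \<cdot>\<^sub>v q) $ i = 0" unfolding eq using i by simp
      ultimately show "(J *\<^sub>v c) $ i = (\<alpha> \<cdot>\<^sub>v c) $ i"
        using i by (simp add: c_def dims algebra_simps del: index_mult_mat_vec)
    qed (simp add: carrier_vecD[OF c])
    have "- c = \<alpha> \<cdot>\<^sub>v (\<alpha> \<cdot>\<^sub>v c)" using jj[OF c \<phi>c] by (simp add: Jc lin)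
    hence "- c $ i = \<alpha> * (\<alpha> * c $ i)" if "i < d" for i
      using that carrier_vecD[OF c] by (metis index_smult_vec(1) index_smult_vec(2) index_uminus_vec(1))
    hence "(1 + \<alpha> * \<alpha>) * c $ i = 0" if "i < d" for i
      using that by (simp add: algebra_simps) (metis add.right_inverse)
    hence "c $ i = 0" if "i < d" for i using that \<open>1 + \<alpha> * \<alpha> \<noteq> 0\<close> by (meson mult_eq_0_iff)
    hence "(J *\<^sub>v p - q) $ i = 0" if "i < d" for i using that unfolding c_def by blast
    hence "q = J *\<^sub>v p" by (intro eq_vecI) (simp_all add: dims del: index_mult_mat_vec)
    thus ?thesis using \<phi>p by (simp add: p_def q_def)
  qed
  show ?thesis by (rule that[OF J(1) \<phi>(1)]) (use jj main in auto)
qed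

section \<open>Parity of kernel dimensions\<close>

text \<open>The square of the determinant of \<open>X\<close> equals (-1)^m and cannot be
  negative.\<close>

lemma even_if_square_eq_uminus:
  fixes X :: "real mat"
  assumes X: "X \<in> carrier_mat m m" and XX: "\<And>v. v \<in> carrier_vec m \<Longrightarrow> X *\<^sub>v (X *\<^sub>v v) = - v"
  shows "even m"
proof -
  have "X * X = - 1 \<cdot>\<^sub>m 1\<^sub>m m"
  proof (rule eq_matI)
    fix i j assume "i < dim_row (- 1 \<cdot>\<^sub>m 1\<^sub>m m :: real mat)" "j < dim_col (- 1 \<cdot>\<^sub>m 1\<^sub>m m :: real mat)"
    hence ij: "i < m" "j < m" by simp_all
    have "Y $$ (i, j) = (Y *\<^sub>v unit_vec m j) $ i" if "Y \<in> carrier_mat m m" for Y :: "real mat"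
      using that ij by simp
    hence "(X * X) $$ (i, j) = ((X * X) *\<^sub>v unit_vec m j) $ i"
      using X by (meson mult_carrier_mat)
    also have "(X * X) *\<^sub>v unit_vec m j = - unit_vec m j"
      using assoc_mult_mat_vec[OF X X unit_vec_carrier] XX[OF unit_vec_carrier] by simp
    finally show "(X * X) $$ (i, j) = (- 1 \<cdot>\<^sub>m 1\<^sub>m m) $$ (i, j)"
      using ij by simp
  qed (use X in simp_all)
  hence "det X * det X = (- 1) ^ m" using det_mult[OF X X] by simp
  thus ?thesis by (metis neg_one_odd_power not_one_le_zero neg_0_le_iff_le zero_le_square)
qed

lemma mult_mat_vec_outer:
  assumes "b \<in> carrier_vec n" "v \<in> carrier_vec n"
  shows "mat m n (\<lambda>(r, c). a $ r * b $ c) *\<^sub>v v = vec m (\<lambda>r. (b \<bullet> v) * a $ r :: real)"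
  using assms by (intro eq_vecI) (auto simp: scalar_prod_def sum_distrib_left mult_ac intro!: sum.cong)

lemma vec1_eq_smult_unit_vec: "s \<in> carrier_vec 1 \<Longrightarrow> s = s $ 0 \<cdot>\<^sub>v unit_vec 1 0" for s :: "real vec"
  by (rule eq_vecI) auto

text \<open>
  The matrix \<open>X\<close>, bordered by the column \<open>- x\<close> and the row \<open>\<psi>\<close>, squares to \<open>- 1\<close> in dimension \<open>m + 1\<close>.
\<close>

lemma odd_if_square_eq_rank_one:
  fixes X :: "real mat"
  assumes X: "X \<in> carrier_mat m m" and x: "x \<in> carrier_vec m" and \<psi>: "\<psi> \<in> carrier_vec m"
    and Xx: "X *\<^sub>v x = 0\<^sub>v m" and \<psi>x: "\<psi> \<bullet> x = 1"
    and \<psi>X: "\<And>v. v \<in> carrier_vec m \<Longrightarrow> \<psi> \<bullet> (X *\<^sub>v v) = 0"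
    and XX: "\<And>v. v \<in> carrier_vec m \<Longrightarrow> X *\<^sub>v (X *\<^sub>v v) = (\<psi> \<bullet> v) \<cdot>\<^sub>v x - v"
  shows "odd m"
proof -
  let ?e = "unit_vec 1 0 :: real vec"
  \<comment> \<open>The added basis vector becomes the partner of \<open>x\<close>, on which
    \<open>X\<close> vanishes: the bordered matrix sends \<open>x\<close> to it, and it to
    \<open>- x\<close>.\<close>
  define B C where "B = mat m 1 (\<lambda>(r, c). x $ r * (- ?e) $ c)" and "C = mat 1 m (\<lambda>(r, c). ?e $ r * \<psi> $ c)"
  have BC: "B \<in> carrier_mat m 1" "C \<in> carrier_mat 1 m" by (simp_all add: B_def C_def)
  define Z where "Z = four_block_mat X B C (0\<^sub>m 1 1)"
  have Z: "Z \<in> carrier_mat (m + 1) (m + 1)"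
    unfolding Z_def by (rule four_block_carrier_mat[OF X]) simp
  have [simp]: "X *\<^sub>v v \<in> carrier_vec m" for v using X unfolding carrier_vec_def by simp
  have B: "B *\<^sub>v (c \<cdot>\<^sub>v ?e) = - c \<cdot>\<^sub>v x" for c
    unfolding B_def using x by (subst mult_mat_vec_outer) (auto intro!: eq_vecI)
  have C: "C *\<^sub>v v = (\<psi> \<bullet> v) \<cdot>\<^sub>v ?e" if "v \<in> carrier_vec m" for v
    unfolding C_def using that \<psi> by (subst mult_mat_vec_outer) (auto intro!: eq_vecI)
  have Zv: "Z *\<^sub>v (v @\<^sub>v c \<cdot>\<^sub>v ?e) = (X *\<^sub>v v - c \<cdot>\<^sub>v x) @\<^sub>v (\<psi> \<bullet> v) \<cdot>\<^sub>v ?e"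
    if "v \<in> carrier_vec m" for v c
  proof -
    have "X *\<^sub>v v + B *\<^sub>v (c \<cdot>\<^sub>v ?e) = X *\<^sub>v v - c \<cdot>\<^sub>v x"
      unfolding B using x X by (intro eq_vecI) (auto simp del: index_mult_mat_vec)
    moreover have "C *\<^sub>v v + 0\<^sub>m 1 1 *\<^sub>v (c \<cdot>\<^sub>v ?e) = (\<psi> \<bullet> v) \<cdot>\<^sub>v ?e"
      unfolding C[OF that] by (intro eq_vecI) auto
    ultimately show ?thesis
      unfolding Z_def using that by (subst four_block_mat_mult_vec[OF X BC zero_carrier_mat]) auto
  qed
  have "Z *\<^sub>v (Z *\<^sub>v y) = - y" if "y \<in> carrier_vec (m + 1)" for y
  proof -
    have "\<forall>y \<in> carrier_vec (m + 1). Z *\<^sub>v (Z *\<^sub>v y) = - y" unfolding all_vec_append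
    proof (intro ballI)
      fix v s :: "real vec" assume v: "v \<in> carrier_vec m" and "s \<in> carrier_vec 1"
      then obtain c where s: "s = c \<cdot>\<^sub>v ?e" using vec1_eq_smult_unit_vec by blast
      have w: "X *\<^sub>v v - c \<cdot>\<^sub>v x \<in> carrier_vec m" using x by simp
      \<comment> \<open>The rank one term left by \<open>XX\<close> is cancelled by the border in
        the second application of \<open>Z\<close>.\<close>
      have "X *\<^sub>v (X *\<^sub>v v - c \<cdot>\<^sub>v x) = (\<psi> \<bullet> v) \<cdot>\<^sub>v x - v"
        using v x X
        by (simp add: mult_minus_distrib_mat_vec[OF X] mult_mat_vec[OF X] Xx XX) (rule eq_vecI; simp)
      moreover have "\<psi> \<bullet> (X *\<^sub>v v - c \<cdot>\<^sub>v x) = - c"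
        using v x \<psi> by (simp add: scalar_prod_minus_distrib[OF \<psi>] scalar_prod_smult_distrib[OF \<psi>] \<psi>X \<psi>x)
      moreover have "(\<psi> \<bullet> v) \<cdot>\<^sub>v x - v - (\<psi> \<bullet> v) \<cdot>\<^sub>v x = - v"
        using v x by (intro eq_vecI) auto
      moreover have "- c \<cdot>\<^sub>v ?e = - (c \<cdot>\<^sub>v ?e)" by (rule eq_vecI) auto
      ultimately show "Z *\<^sub>v (Z *\<^sub>v (v @\<^sub>v s)) = - (v @\<^sub>v s)"
        unfolding s Zv[OF v] Zv[OF w] by (simp add: uminus_append_vec)
    qed
    thus ?thesis using that by blast
  qed
  hence "even (m + 1)" using even_if_square_eq_uminus[OF Z] by blast
  thus ?thesis by simp
qed

text \<open>
  The columns of \<open>B\<close> form a basis of the kernel of \<open>A\<close>, and \<open>C\<close> reads off coordinates.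
\<close>

definition has_nullity :: "real mat \<Rightarrow> nat \<Rightarrow> bool" where
  "has_nullity A m \<longleftrightarrow>
     (\<exists>B \<in> carrier_mat (dim_col A) m. \<exists>C \<in> carrier_mat m (dim_col A).
       (\<forall>v \<in> carrier_vec (dim_col A). A *\<^sub>v v = 0\<^sub>v (dim_row A) \<longrightarrow> B *\<^sub>v (C *\<^sub>v v) = v) \<and>
       (\<forall>x \<in> carrier_vec m. C *\<^sub>v (B *\<^sub>v x) = x \<and> A *\<^sub>v (B *\<^sub>v x) = 0\<^sub>v (dim_row A)))"

lemma has_nullityE:
  assumes "has_nullity A m" "A \<in> carrier_mat nr nc"
  obtains B C where "B \<in> carrier_mat nc m" "C \<in> carrier_mat m nc"
    "\<And>v. v \<in> carrier_vec nc \<Longrightarrow> A *\<^sub>v v = 0\<^sub>v nr \<Longrightarrow> B *\<^sub>v (C *\<^sub>v v) = v"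
    "\<And>x. x \<in> carrier_vec m \<Longrightarrow> C *\<^sub>v (B *\<^sub>v x) = x"
    "\<And>x. x \<in> carrier_vec m \<Longrightarrow> A *\<^sub>v (B *\<^sub>v x) = 0\<^sub>v nr"
  using assms unfolding has_nullity_def by auto

lemma has_nullityI:
  assumes "A \<in> carrier_mat nr nc" "B \<in> carrier_mat nc m" "C \<in> carrier_mat m nc"
    "\<And>v. v \<in> carrier_vec nc \<Longrightarrow> A *\<^sub>v v = 0\<^sub>v nr \<Longrightarrow> B *\<^sub>v (C *\<^sub>v v) = v"
    "\<And>x. x \<in> carrier_vec m \<Longrightarrow> C *\<^sub>v (B *\<^sub>v x) = x"
    "\<And>x. x \<in> carrier_vec m \<Longrightarrow> A *\<^sub>v (B *\<^sub>v x) = 0\<^sub>v nr"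
  shows "has_nullity A m"
  unfolding has_nullity_def using assms by (intro bexI[of _ B] bexI[of _ C]) auto

text \<open>
  If the kernel of \<open>A\<close> lies in the hyperplane \<open>ker \<phi>\<close>, it is stable under \<open>J\<close>.  Otherwise choose \<open>u\<close> in it
  with \<open>\<phi> \<bullet> u = 1\<close>: then \<open>J\<close>, extended by \<open>0\<close> on \<open>u\<close>, squares to \<open>- 1\<close> up to a rank one projection.
\<close>

lemma even_nullity_iff:
  assumes A: "A \<in> carrier_mat nr d" "has_nullity A m"
    and J: "J \<in> carrier_mat d d" and \<phi>: "\<phi> \<in> carrier_vec d"
    and \<phi>J: "\<And>w. w \<in> carrier_vec d \<Longrightarrow> \<phi> \<bullet> w = 0 \<Longrightarrow> \<phi> \<bullet> (J *\<^sub>v w) = 0"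
    and JJ: "\<And>w. w \<in> carrier_vec d \<Longrightarrow> \<phi> \<bullet> w = 0 \<Longrightarrow> J *\<^sub>v (J *\<^sub>v w) = - w"
    and ker: "\<And>w. w \<in> carrier_vec d \<Longrightarrow> \<phi> \<bullet> w = 0 \<Longrightarrow> A *\<^sub>v w = 0\<^sub>v nr \<Longrightarrow> A *\<^sub>v (J *\<^sub>v w) = 0\<^sub>v nr"
  shows "even m \<longleftrightarrow> (\<forall>w \<in> carrier_vec d. A *\<^sub>v w = 0\<^sub>v nr \<longrightarrow> \<phi> \<bullet> w = 0)"
proof -
  obtain B C where BC: "B \<in> carrier_mat d m" "C \<in> carrier_mat m d"
    and B1: "\<And>v. v \<in> carrier_vec d \<Longrightarrow> A *\<^sub>v v = 0\<^sub>v nr \<Longrightarrow> B *\<^sub>v (C *\<^sub>v v) = v"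
    and C1: "\<And>x. x \<in> carrier_vec m \<Longrightarrow> C *\<^sub>v (B *\<^sub>v x) = x"
    and AB: "\<And>x. x \<in> carrier_vec m \<Longrightarrow> A *\<^sub>v (B *\<^sub>v x) = 0\<^sub>v nr"
    using has_nullityE[OF A(2,1)] by blast
  have [simp]: "B *\<^sub>v v \<in> carrier_vec d" "C *\<^sub>v v \<in> carrier_vec m" "J *\<^sub>v v \<in> carrier_vec d" for v
    using BC J unfolding carrier_vec_def by simp_all
  have Cm: "C *\<^sub>v (- v) = - (C *\<^sub>v v)" if "v \<in> carrier_vec d" for v
    using that BC by (intro eq_vecI) auto
  show ?thesis
  proof (cases "\<forall>w \<in> carrier_vec d. A *\<^sub>v w = 0\<^sub>v nr \<longrightarrow> \<phi> \<bullet> w = 0")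
    case True
    \<comment> \<open>\<open>X\<close> is the restriction of \<open>J\<close> to the kernel, in the
      coordinates given by \<open>B\<close> and \<open>C\<close>.\<close>
    define X where "X = C * (J * B)"
    have X: "X \<in> carrier_mat m m" unfolding X_def using BC J by auto
    have Xv: "X *\<^sub>v v = C *\<^sub>v (J *\<^sub>v (B *\<^sub>v v))" if "v \<in> carrier_vec m" for v
      unfolding X_def using that BC J
      by (simp add: assoc_mult_mat_vec[of C m d "J * B" m] assoc_mult_mat_vec[of J d d B m])
    have "X *\<^sub>v (X *\<^sub>v v) = - v" if v: "v \<in> carrier_vec m" for v
    proof -
      have \<phi>Bv: "\<phi> \<bullet> (B *\<^sub>v v) = 0" using True AB[OF v] by simp
      have "B *\<^sub>v (C *\<^sub>v (J *\<^sub>v (B *\<^sub>v v))) = J *\<^sub>v (B *\<^sub>v v)"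
        by (rule B1) (use ker \<phi>Bv AB[OF v] in simp_all)
      thus ?thesis using v by (simp add: Xv JJ \<phi>Bv Cm C1)
    qed
    hence "even m" using even_if_square_eq_uminus[OF X] by blast
    thus ?thesis using True by blast
  next
    case False
    then obtain u' where u': "u' \<in> carrier_vec d" "A *\<^sub>v u' = 0\<^sub>v nr" "\<phi> \<bullet> u' \<noteq> 0" by blast
    define u where "u = (1 / (\<phi> \<bullet> u')) \<cdot>\<^sub>v u'"
    have u [simp]: "u \<in> carrier_vec d" using u' by (simp add: u_def)
    have \<phi>u: "\<phi> \<bullet> u = 1" using u' by (simp add: u_def scalar_prod_smult_distrib[OF \<phi>])
    have Au: "A *\<^sub>v u = 0\<^sub>v nr" unfolding u_def mult_mat_vec[OF A(1) u'(1)] u'(2) by (rule eq_vecI) auto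
    define \<psi> where "\<psi> = transpose_mat B *\<^sub>v \<phi>"
    have \<psi>: "\<psi> \<in> carrier_vec m" unfolding \<psi>_def
      by (rule mult_mat_vec_carrier[OF _ \<phi>]) (use BC in simp)
    have \<psi>v: "\<psi> \<bullet> v = \<phi> \<bullet> (B *\<^sub>v v)" if "v \<in> carrier_vec m" for v
      unfolding \<psi>_def by (rule transpose_vec_mult_scalar[OF BC(1) that \<phi>])
    \<comment> \<open>Subtracting \<open>S\<close> amounts to projecting onto the hyperplane along
      \<open>u\<close> before applying \<open>J\<close>; this projection is \<open>w\<close>
      below.\<close>
    define S where "S = mat m m (\<lambda>(r, c). (C *\<^sub>v (J *\<^sub>v u)) $ r * \<psi> $ c)"
    have S: "S \<in> carrier_mat m m" by (simp add: S_def)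
    have Sv: "S *\<^sub>v v = (\<psi> \<bullet> v) \<cdot>\<^sub>v (C *\<^sub>v (J *\<^sub>v u))" if "v \<in> carrier_vec m" for v
      unfolding S_def mult_mat_vec_outer[OF \<psi> that]
      using BC by (intro eq_vecI) (simp_all del: index_mult_mat_vec)
    define X where "X = C * (J * B) - S"
    have X: "X \<in> carrier_mat m m" unfolding X_def using S by (rule minus_carrier_mat)
    define w where "w v = B *\<^sub>v v - (\<psi> \<bullet> v) \<cdot>\<^sub>v u" for v
    have w: "w v \<in> carrier_vec d" "\<phi> \<bullet> w v = 0" "A *\<^sub>v w v = 0\<^sub>v nr" if v: "v \<in> carrier_vec m" for v
    proof -
      show "w v \<in> carrier_vec d" by (simp add: w_def)
      show "\<phi> \<bullet> w v = 0"
        by (simp add: w_def scalar_prod_minus_distrib[OF \<phi>] scalar_prod_smult_distrib[OF \<phi>] \<phi>u \<psi>v[OF v])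
      show "A *\<^sub>v w v = 0\<^sub>v nr"
        by (simp add: w_def mult_minus_distrib_mat_vec[OF A(1)] mult_mat_vec[OF A(1)] AB[OF v] Au)
          (rule eq_vecI; simp)
    qed
    have Xv: "X *\<^sub>v v = C *\<^sub>v (J *\<^sub>v w v)" if v: "v \<in> carrier_vec m" for v
    proof -
      have "X *\<^sub>v v = (C * (J * B)) *\<^sub>v v - (\<psi> \<bullet> v) \<cdot>\<^sub>v (C *\<^sub>v (J *\<^sub>v u))"
        unfolding X_def Sv[OF v, symmetric]
        by (rule minus_mult_distrib_mat_vec[OF _ S v]) (use BC J in auto)
      also have "(C * (J * B)) *\<^sub>v v = C *\<^sub>v (J *\<^sub>v (B *\<^sub>v v))"
        using v BC J
        by (simp add: assoc_mult_mat_vec[of C m d "J * B" m] assoc_mult_mat_vec[of J d d B m])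
      also have "C *\<^sub>v (J *\<^sub>v (B *\<^sub>v v)) - (\<psi> \<bullet> v) \<cdot>\<^sub>v (C *\<^sub>v (J *\<^sub>v u)) = C *\<^sub>v (J *\<^sub>v w v)"
        by (simp add: w_def mult_minus_distrib_mat_vec[OF J] mult_mat_vec[OF J]
            mult_minus_distrib_mat_vec[OF BC(2)] mult_mat_vec[OF BC(2)])
      finally show ?thesis .
    qed
    have BX: "B *\<^sub>v (X *\<^sub>v v) = J *\<^sub>v w v" if v: "v \<in> carrier_vec m" for v
      unfolding Xv[OF v] by (rule B1) (use ker w[OF v] in simp_all)
    have Xc: "X *\<^sub>v v \<in> carrier_vec m" for v using X unfolding carrier_vec_def by simp
    have \<psi>X: "\<psi> \<bullet> (X *\<^sub>v v) = 0" if v: "v \<in> carrier_vec m" for v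
      by (simp add: \<psi>v[OF Xc] BX[OF v] \<phi>J w[OF v])
    have C0: "C *\<^sub>v (J *\<^sub>v 0\<^sub>v d) = 0\<^sub>v m"
    proof -
      have "J *\<^sub>v 0\<^sub>v d = 0\<^sub>v d" "C *\<^sub>v 0\<^sub>v d = 0\<^sub>v m" using J BC by (auto intro!: eq_vecI)
      thus ?thesis by simp
    qed
    have "odd m"
    proof (rule odd_if_square_eq_rank_one[OF X _ \<psi>])
      have BCu: "B *\<^sub>v (C *\<^sub>v u) = u" by (rule B1[OF u Au])
      show "\<psi> \<bullet> (C *\<^sub>v u) = 1" by (simp add: \<psi>v BCu \<phi>u)
      hence "w (C *\<^sub>v u) = 0\<^sub>v d" unfolding w_def BCu by (auto simp: carrier_vecD[OF u] intro!: eq_vecI)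
      thus "X *\<^sub>v (C *\<^sub>v u) = 0\<^sub>v m" by (simp add: Xv C0)
      show "X *\<^sub>v (X *\<^sub>v v) = (\<psi> \<bullet> v) \<cdot>\<^sub>v (C *\<^sub>v u) - v" if v: "v \<in> carrier_vec m" for v
      proof -
        \<comment> \<open>The image of \<open>X\<close> already lies in the hyperplane, so the
          second projection changes nothing.\<close>
        have "w (X *\<^sub>v v) = J *\<^sub>v w v - 0 \<cdot>\<^sub>v u"
          unfolding w_def[of "X *\<^sub>v v"] BX[OF v] \<psi>X[OF v] ..
        also have "\<dots> = J *\<^sub>v w v" by (rule eq_vecI) (use J u in \<open>auto simp del: u\<close>)
        finally have "X *\<^sub>v (X *\<^sub>v v) = C *\<^sub>v (J *\<^sub>v (J *\<^sub>v w v))" by (simp add: Xv[OF Xc])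
        also have "\<dots> = - (C *\<^sub>v w v)" using w[OF v] by (simp add: JJ Cm)
        also have "C *\<^sub>v w v = v - (\<psi> \<bullet> v) \<cdot>\<^sub>v (C *\<^sub>v u)"
          by (simp add: w_def mult_minus_distrib_mat_vec[OF BC(2)] mult_mat_vec[OF BC(2)] C1[OF v])
        also have "- (v - (\<psi> \<bullet> v) \<cdot>\<^sub>v (C *\<^sub>v u)) = (\<psi> \<bullet> v) \<cdot>\<^sub>v (C *\<^sub>v u) - v"
          using v BC by (intro eq_vecI) auto
        finally show ?thesis .
      qed
    qed (use \<psi>X in simp_all)
    thus ?thesis using False by blast
  qed
qed

section \<open>Multiplicities from kernel parities\<close>

text \<open>
  \<open>N i\<close> is the dimension of the kernel of the \<open>i\<close>-th power.  By \<open>mono\<close> it is odd exactly from some \<open>s\<close> on.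
  Its second difference at \<open>i\<close> is \<open>- m i\<close>, where \<open>m i\<close> is the number of blocks of size \<open>i\<close>, so \<open>m i\<close> is odd
  only for \<open>i = s\<close> and \<open>i = s - 1\<close>.
\<close>

lemma jordan_type_parity:
  fixes N ns ps :: "nat \<Rightarrow> nat"
  assumes k: "k \<ge> 1"
    and decr: "\<forall>i \<in> {1..k}. \<forall>i' \<in> {1..k}. i < i' \<longrightarrow> ns i' < ns i"
    and ns2: "\<forall>i \<in> {1..k}. ns i \<ge> 2"
    and N: "\<And>i. N i = (\<Sum>l = 1..k. ps l * min i (ns l)) + t * min i 1"
    and odd: "odd ((\<Sum>l = 1..k. ns l * ps l) + t)"
    and mono: "\<And>i. even (N (Suc i)) \<Longrightarrow> even (N i)"
  shows "(odd t \<and> (\<forall>i \<in> {1..k}. even (ps i))) \<or>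
      (odd t \<and> (\<forall>i \<in> {1..k - 1}. even (ps i)) \<and> ns k = 2 \<and> odd (ps k)) \<or>
      (even t \<and> k \<ge> 2 \<and>
        (\<exists>l \<in> {2..k}. ns (l - 1) = ns l + 1 \<and> odd (ps (l - 1)) \<and> odd (ps l) \<and>
          (\<forall>i \<in> {1..k} - {l - 1, l}. even (ps i))))"
proof -
  have less: "ns i' < ns i" if "i \<in> {1..k}" "i' \<in> {1..k}" "i < i'" for i i' using decr that by blast
  have inj: "i = i'" if "i \<in> {1..k}" "i' \<in> {1..k}" "ns i = ns i'" for i i'
    using less[of i i'] less[of i' i] that by (metis less_irrefl nat_neq_iff)
  have "\<exists>i. odd (N i)"
  proof
    \<comment> \<open>An exponent exceeding all block sizes and at least 1, so that every minimum in
      \<open>N\<close> is attained by the block size and \<open>N ?b\<close> is the full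
      dimension.\<close>
    let ?b = "Suc (\<Sum>l = 1..k. ns l)"
    have "min ?b (ns l) = ns l" if "l \<in> {1..k}" for l
      using member_le_sum[of l "{1..k}" ns] that by simp
    hence "N ?b = (\<Sum>l = 1..k. ns l * ps l) + t"
      unfolding N by (intro arg_cong2[of _ _ _ _ "(+)"] sum.cong) auto
    thus "odd (N ?b)" using odd by simp
  qed
  define s where "s = (LEAST i. odd (N i))"
  have "odd (N s)" unfolding s_def by (rule LeastI_ex) fact
  have odd_iff: "odd (N i) \<longleftrightarrow> s \<le> i" for i
  proof
    show "s \<le> i" if "odd (N i)" unfolding s_def using that by (rule Least_le)
    show "odd (N i)" if "s \<le> i" using that by (induction rule: dec_induct) (use \<open>odd (N s)\<close> mono in blast)+
  qed
  have "s \<noteq> 0" using \<open>odd (N s)\<close> by (cases "s = 0") (auto simp: N)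
  define m where "m i = (\<Sum>l = 1..k. if ns l = i then ps l else 0) + (if i = 1 then t else 0)" for i
  have odd_m: "odd (m i) \<longleftrightarrow> i = s \<or> Suc i = s" if i: "i \<ge> 1" for i
  proof -
    \<comment> \<open>As a function of \<open>i\<close>, \<open>min i n\<close> is linear except for
      a bend at \<open>n\<close>, where the slope drops from 1 to 0. Moving the terms to one side
      avoids subtraction of naturals.\<close>
    have *: "p * min (Suc i) n + p * min (i - 1) n + (if n = i then p else 0) = 2 * (p * min i n)"
      for p n :: nat
      using i by (cases i) (auto simp: min_def algebra_simps not_le le_Suc_eq)
    have "(N (Suc i) + N (i - 1)) + m i = (\<Sum>l = 1..k. ps l * min (Suc i) (ns l) + ps l * min (i - 1) (ns l)
        + (if ns l = i then ps l else 0)) + (t * min (Suc i) 1 + t * min (i - 1) 1 + (if 1 = i then t else 0))"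
      unfolding N m_def by (simp add: sum.distrib)
    also have "\<dots> = 2 * N i" unfolding * N by (simp add: sum_distrib_left)
    finally have "even ((N (Suc i) + N (i - 1)) + m i)" by simp
    \<comment> \<open>The term \<open>2 * N i\<close> drops out modulo 2, so the threshold must lie
      between \<open>i\<close> and \<open>Suc i\<close>.\<close>
    hence "odd (m i) \<longleftrightarrow> (s \<le> Suc i) \<noteq> (s \<le> i - 1)" using odd_iff by (metis even_add)
    thus ?thesis using i \<open>s \<noteq> 0\<close> by auto
  qed
  have m_ns: "m (ns l) = ps l" if l: "l \<in> {1..k}" for l
  proof -
    have "(\<Sum>l' = 1..k. if ns l' = ns l then ps l' else 0) = (\<Sum>l' = 1..k. if l' = l then ps l' else 0)"
      by (rule sum.cong) (use inj l in auto)
    moreover have "ns l \<noteq> 1" using ns2 l by fastforce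
    ultimately show ?thesis using l by (simp add: m_def)
  qed
  have "(\<Sum>l = 1..k. if ns l = 1 then ps l else 0) = 0" using ns2 by (intro sum.neutral) auto
  hence "m 1 = t" by (simp add: m_def)
  hence odd_t: "odd t \<longleftrightarrow> s = 1 \<or> s = 2" using odd_m[of 1] by auto
  have odd_p: "odd (ps l) \<longleftrightarrow> ns l = s \<or> Suc (ns l) = s" if "l \<in> {1..k}" for l
    using odd_m[of "ns l"] m_ns[OF that] ns2 that by force
  have ex: "\<exists>l \<in> {1..k}. ns l = i" if "i \<ge> 2" "odd (m i)" for i
  proof (rule ccontr)
    assume "\<not> ?thesis"
    hence "(\<Sum>l = 1..k. if ns l = i then ps l else 0) = 0" by (intro sum.neutral) auto
    thus False using that by (simp add: m_def)
  qed
  \<comment> \<open>The cases say how many of the sizes \<open>s - 1\<close> and \<open>s\<close>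
    are at least 2, hence sizes of listed blocks: none, one or both.\<close>
  consider "s = 1" | "s = 2" | "s \<ge> 3" using \<open>s \<noteq> 0\<close> by linarith
  thus ?thesis
  proof cases
    case 1
    have "even (ps l)" if "l \<in> {1..k}" for l
      using odd_p[OF that] 1 ns2 that by fastforce
    thus ?thesis using odd_t 1 by blast
  next
    case 2
    obtain l where l: "l \<in> {1..k}" "ns l = 2" using ex[of 2] odd_m[of 2] 2 by auto
    have kk: "k \<in> {1..k}" using k by simp
    \<comment> \<open>Sizes decrease strictly and are at least 2, so the size 2 can only come
      last.\<close>
    have "l = k" using less[OF l(1) kk] ns2 kk l by (metis atLeastAtMost_iff le_neq_implies_less not_le)
    hence nk: "ns k = 2" using l by simp
    have "even (ps i)" if i: "i \<in> {1..k - 1}" for i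
    proof -
      have "i \<in> {1..k}" "i < k" using i by auto
      hence "ns i > 2" using less[OF _ kk] nk by metis
      thus ?thesis using odd_p[of i] \<open>i \<in> {1..k}\<close> 2 by auto
    qed
    moreover have "odd t" "odd (ps k)" using odd_t 2 nk odd_p[OF kk] by simp_all
    ultimately show ?thesis using nk by blast
  next
    case 3
    have s1: "s - 1 \<ge> 2" "Suc (s - 1) = s" using 3 by auto
    hence "odd (m (s - 1))" "odd (m s)" using odd_m[of "s - 1"] odd_m[of s] by auto
    then obtain l l' where "l \<in> {1..k}" "ns l = s - 1" "l' \<in> {1..k}" "ns l' = s"
      using ex[of "s - 1"] ex[of s] 3 s1 by auto
    hence l: "l \<in> {1..k}" "Suc (ns l) = s" and l': "l' \<in> {1..k}" "ns l' = s" using s1 by auto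
    have "l' < l" using less[OF l(1) l'(1)] l l' by (cases l l' rule: linorder_cases) auto
    \<comment> \<open>An index between \<open>l'\<close> and \<open>l\<close> would need a size
      strictly between \<open>s\<close> and \<open>s - 1\<close>.\<close>
    moreover have "\<not> l' < l - 1"
    proof
      assume "l' < l - 1"
      hence l1: "l - 1 \<in> {1..k}" "l - 1 < l" using l by auto
      show False
        using less[OF l'(1) l1(1) \<open>l' < l - 1\<close>] less[OF l1(1) l(1) l1(2)] l(2) l'(2) by linarith
    qed
    ultimately have l'_eq: "l' = l - 1" by linarith
    have "even (ps i)" if "i \<in> {1..k} - {l - 1, l}" for i
      using odd_p[of i] inj[of i l] inj[of i l'] that l l' l'_eq 3 by auto
    moreover have "odd (ps (l - 1))" "odd (ps l)" using odd_p[OF l(1)] odd_p[OF l'(1)] l l' l'_eq 3 by auto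
    moreover have "ns (l - 1) = ns l + 1" using l l' l'_eq 3 by simp
    moreover have "l \<in> {2..k}" "k \<ge> 2" using \<open>l' < l\<close> l l' by auto
    moreover have "even t" using odd_t 3 by simp
    ultimately show ?thesis by blast
  qed
qed

section \<open>Kernel dimensions of powers of Jordan matrices\<close>

lemma has_nullity_dsum:
  assumes A: "A \<in> carrier_mat m m" "has_nullity A a" and B: "B \<in> carrier_mat n n" "has_nullity B b"
  shows "has_nullity (mat_dsum A B) (a + b)"
proof -
  obtain P Q where PQ: "P \<in> carrier_mat m a" "Q \<in> carrier_mat a m"
    and h: "\<And>v. v \<in> carrier_vec m \<Longrightarrow> A *\<^sub>v v = 0\<^sub>v m \<Longrightarrow> P *\<^sub>v (Q *\<^sub>v v) = v"
    "\<And>x. x \<in> carrier_vec a \<Longrightarrow> Q *\<^sub>v (P *\<^sub>v x) = x"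
    "\<And>x. x \<in> carrier_vec a \<Longrightarrow> A *\<^sub>v (P *\<^sub>v x) = 0\<^sub>v m"
    using has_nullityE[OF A(2,1)] by blast
  obtain R S where RS: "R \<in> carrier_mat n b" "S \<in> carrier_mat b n"
    and h': "\<And>v. v \<in> carrier_vec n \<Longrightarrow> B *\<^sub>v v = 0\<^sub>v n \<Longrightarrow> R *\<^sub>v (S *\<^sub>v v) = v"
    "\<And>x. x \<in> carrier_vec b \<Longrightarrow> S *\<^sub>v (R *\<^sub>v x) = x"
    "\<And>x. x \<in> carrier_vec b \<Longrightarrow> B *\<^sub>v (R *\<^sub>v x) = 0\<^sub>v n"
    using has_nullityE[OF B(2,1)] by blast
  have [simp]: "P *\<^sub>v v \<in> carrier_vec m" "Q *\<^sub>v v \<in> carrier_vec a" "A *\<^sub>v v \<in> carrier_vec m"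
    "R *\<^sub>v v \<in> carrier_vec n" "S *\<^sub>v v \<in> carrier_vec b" "B *\<^sub>v v \<in> carrier_vec n" for v
    using PQ RS A B unfolding carrier_vec_def by simp_all
  note d = mat_dsum_mult_vec[OF A(1) B(1)] mat_dsum_mult_vec[OF PQ(1) RS(1)]
    mat_dsum_mult_vec[OF PQ(2) RS(2)]
  have z: "0\<^sub>v (m + n) = (0\<^sub>v m @\<^sub>v 0\<^sub>v n :: real vec)" by (auto intro!: eq_vecI)
  have 1: "\<forall>v \<in> carrier_vec (m + n). mat_dsum A B *\<^sub>v v = 0\<^sub>v (m + n) \<longrightarrow>
      mat_dsum P R *\<^sub>v (mat_dsum Q S *\<^sub>v v) = v"
    unfolding all_vec_append z by (auto simp: d h h' append_vec_eq[of _ m])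
  have 2: "\<forall>x \<in> carrier_vec (a + b). mat_dsum Q S *\<^sub>v (mat_dsum P R *\<^sub>v x) = x \<and>
      mat_dsum A B *\<^sub>v (mat_dsum P R *\<^sub>v x) = 0\<^sub>v (m + n)"
    unfolding all_vec_append z by (auto simp: d h h')
  show ?thesis
    by (rule has_nullityI[of _ "m + n" "m + n" "mat_dsum P R" _ "mat_dsum Q S"])
      (use 1 2 A B PQ RS in \<open>auto intro!: carrier_matI\<close>)
qed

text \<open>\<open>P\<close> maps the kernel of \<open>D\<close> onto that of \<open>A\<close>, and
  \<open>Q\<close> maps it back.\<close>

lemma has_nullity_similar:
  assumes A: "A \<in> carrier_mat d d" and wit: "similar_mat_wit A D P Q" and D: "has_nullity D m"
  shows "has_nullity A m"
proof -
  note w = similar_mat_witD2[OF A wit]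
  have P: "P \<in> carrier_mat d d" and Q: "Q \<in> carrier_mat d d" and Dc: "D \<in> carrier_mat d d" using w by auto
  note sim = mult_mat_vec_similar[OF A wit]
  obtain B C where BC: "B \<in> carrier_mat d m" "C \<in> carrier_mat m d"
    and h: "\<And>v. v \<in> carrier_vec d \<Longrightarrow> D *\<^sub>v v = 0\<^sub>v d \<Longrightarrow> B *\<^sub>v (C *\<^sub>v v) = v"
    "\<And>x. x \<in> carrier_vec m \<Longrightarrow> C *\<^sub>v (B *\<^sub>v x) = x"
    "\<And>x. x \<in> carrier_vec m \<Longrightarrow> D *\<^sub>v (B *\<^sub>v x) = 0\<^sub>v d"
    using has_nullityE[OF D Dc] by blast
  have car: "P *\<^sub>v v \<in> carrier_vec d" "Q *\<^sub>v v \<in> carrier_vec d" "B *\<^sub>v v \<in> carrier_vec d"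
    "C *\<^sub>v v \<in> carrier_vec m" "D *\<^sub>v v \<in> carrier_vec d" for v
    using P Q BC Dc unfolding carrier_vec_def by simp_all
  have 0: "P *\<^sub>v 0\<^sub>v d = 0\<^sub>v d" "Q *\<^sub>v 0\<^sub>v d = 0\<^sub>v d" using P Q by (auto intro!: eq_vecI)
  have PB: "(P * B) *\<^sub>v v = P *\<^sub>v (B *\<^sub>v v)" if "v \<in> carrier_vec m" for v
    by (rule assoc_mult_mat_vec[OF P BC(1) that])
  have CQ: "(C * Q) *\<^sub>v v = C *\<^sub>v (Q *\<^sub>v v)" if "v \<in> carrier_vec d" for v
    by (rule assoc_mult_mat_vec[OF BC(2) Q that])
  show ?thesis
  proof (rule has_nullityI[OF A, of "P * B" _ "C * Q"])
    fix v assume v: "v \<in> carrier_vec d" "A *\<^sub>v v = 0\<^sub>v d"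
    have "D *\<^sub>v (Q *\<^sub>v v) = Q *\<^sub>v (A *\<^sub>v v)" by (simp add: sim(1)[OF v(1)] sim(3)[OF car(5)])
    hence "D *\<^sub>v (Q *\<^sub>v v) = 0\<^sub>v d" using v by (simp add: 0)
    thus "(P * B) *\<^sub>v ((C * Q) *\<^sub>v v) = v" using v by (simp add: CQ PB car h sim)
  next
    fix x :: "real vec" assume x: "x \<in> carrier_vec m"
    show "(C * Q) *\<^sub>v ((P * B) *\<^sub>v x) = x" "A *\<^sub>v ((P * B) *\<^sub>v x) = 0\<^sub>v d"
      using x by (simp_all add: PB CQ car sim h 0)
  qed (use P Q BC in auto)
qed

lemma nilpotent_jordan_block_pow_mult_vec:
  assumes "v \<in> carrier_vec n"
  shows "nilpotent_jordan_block n ^\<^sub>m i *\<^sub>v v = vec n (\<lambda>r. if r < i then 0 else v $ (r - i))"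
  using assms
proof (induction i arbitrary: v)
  case 0
  thus ?case by (simp add: nilpotent_jordan_block_def) (rule eq_vecI; simp)
next
  case (Suc i)
  let ?N = "nilpotent_jordan_block n"
  have N: "?N \<in> carrier_mat n n" by (simp add: nilpotent_jordan_block_def)
  \<comment> \<open>Row 0 has coefficient 0, which absorbs the truncated
    \<open>0 - 1\<close>.\<close>
  have "?N = mat n n (\<lambda>(r, c). if c = r - 1 then (if r = 0 then 0 else 1) else 0)"
    by (rule eq_matI) (auto simp: nilpotent_jordan_block_def)
  hence Nv: "?N *\<^sub>v v = vec n (\<lambda>r. (if r = 0 then 0 else 1) * v $ (r - 1))"
    using mult_mat_vec_single_entry[OF Suc.prems,
        where m = n and g = "\<lambda>r. r - 1" and c = "\<lambda>r. if r = 0 then 0 else 1"] by simp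
  have "?N ^\<^sub>m Suc i *\<^sub>v v = ?N ^\<^sub>m i *\<^sub>v (?N *\<^sub>v v)"
    using N Suc.prems by (simp add: assoc_mult_mat_vec[of _ n n _ n])
  also have "\<dots> = vec n (\<lambda>r. if r < i then 0 else (?N *\<^sub>v v) $ (r - i))"
    by (rule Suc.IH) (simp add: Nv)
  also have "\<dots> = vec n (\<lambda>r. if r < Suc i then 0 else v $ (r - Suc i))"
    unfolding Nv by (rule eq_vecI) (auto simp: less_Suc_eq)
  finally show ?case .
qed

text \<open>The power shifts coordinates down by \<open>i\<close>, so its kernel is spanned by the
  last \<open>min i n\<close> basis vectors. \<open>B\<close> includes these coordinates and
  \<open>C\<close> reads them off.\<close>

lemma has_nullity_nilpotent_jordan_block_pow:
  "has_nullity (nilpotent_jordan_block n ^\<^sub>m i) (min i n)"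
proof -
  define m where "m = min i n"
  let ?A = "nilpotent_jordan_block n ^\<^sub>m i"
  have A: "?A \<in> carrier_mat n n" by (rule pow_carrier_mat) (simp add: nilpotent_jordan_block_def)
  note Av = nilpotent_jordan_block_pow_mult_vec
  define B :: "real mat" where "B = mat n m (\<lambda>(r, c).
    if c = r - (n - m) then (if r < n - m then 0 else 1) else 0)"
  define C :: "real mat" where "C = mat m n (\<lambda>(r, c). if c = r + (n - m) then 1 else 0)"
  have mn: "m \<le> n" by (simp add: m_def)
  have Bv: "B *\<^sub>v x = vec n (\<lambda>r. (if r < n - m then 0 else 1) * x $ (r - (n - m)))"
    if "x \<in> carrier_vec m" for x
    unfolding B_def using mn by (intro mult_mat_vec_single_entry[OF that]) (auto split: if_splits)
  have Cv: "C *\<^sub>v v = vec m (\<lambda>r. 1 * v $ (r + (n - m)))" if "v \<in> carrier_vec n" for v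
    unfolding C_def using mn by (intro mult_mat_vec_single_entry[OF that]) auto
  have "has_nullity ?A m"
  proof (rule has_nullityI[OF A, of B _ C])
    fix v assume v: "v \<in> carrier_vec n" "?A *\<^sub>v v = 0\<^sub>v n"
    \<comment> \<open>Such an entry is not shifted out: it reappears at position
      \<open>c + i\<close> of the image, which is zero.\<close>
    have 0: "v $ c = 0" if c: "c < n - m" for c
    proof -
      have "c + i < n" using c by (auto simp: m_def min_def split: if_splits)
      moreover from this have "(?A *\<^sub>v v) $ (c + i) = 0" unfolding v(2) by simp
      ultimately show ?thesis unfolding Av[OF v(1)] by simp
    qed
    have Cc: "C *\<^sub>v v \<in> carrier_vec m" using Cv[OF v(1)] by simp
    show "B *\<^sub>v (C *\<^sub>v v) = v"
      unfolding Bv[OF Cc] unfolding Cv[OF v(1)] using v(1) mn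
      by (intro eq_vecI) (auto simp: 0)
  next
    fix x :: "real vec" assume x: "x \<in> carrier_vec m"
    have Bc: "B *\<^sub>v x \<in> carrier_vec n" using Bv[OF x] by simp
    show "C *\<^sub>v (B *\<^sub>v x) = x"
      unfolding Cv[OF Bc] unfolding Bv[OF x] using x mn by (intro eq_vecI) auto
    show "?A *\<^sub>v (B *\<^sub>v x) = 0\<^sub>v n"
      unfolding Av[OF Bc] unfolding Bv[OF x] by (intro eq_vecI) (auto simp: m_def)
  qed (simp_all add: B_def C_def)
  thus ?thesis by (simp add: m_def)
qed

lemma has_nullity_jordan_blocks_pow:
  "has_nullity (diag_block_mat (map nilpotent_jordan_block ds) ^\<^sub>m i) (\<Sum>n \<leftarrow> ds. min i n)"
proof -
  let ?P = "\<lambda>n. nilpotent_jordan_block n ^\<^sub>m i"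
  have P: "?P n \<in> carrier_mat n n" for n by (rule pow_carrier_mat) (simp add: nilpotent_jordan_block_def)
  have "has_nullity (diag_block_mat (map ?P ds)) (\<Sum>n \<leftarrow> ds. min i n)"
  proof (induction ds)
    case Nil
    show ?case by (rule has_nullityI[of _ 0 0 "0\<^sub>m 0 0" _ "0\<^sub>m 0 0"]) (auto intro!: eq_vecI)
  next
    case (Cons n ds)
    have "diag_block_mat (map ?P (n # ds)) = mat_dsum (?P n) (diag_block_mat (map ?P ds))"
      by (simp add: mat_dsum_def Let_def)
    moreover have sq: "Ball (set (map ?P ds)) square_mat" using P by auto
    ultimately show ?case
      using has_nullity_dsum[OF P has_nullity_nilpotent_jordan_block_pow diag_block_mat_carrier[OF sq] Cons]
      by simp
  qed
  moreover have "Ball (set (map nilpotent_jordan_block ds)) square_mat" by auto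
  ultimately show ?thesis by (simp add: diag_block_pow_mat o_def del: square_mat.simps)
qed

text \<open>This lets the zero part enter the nullity count as \<open>t\<close> further blocks,
  contributing \<open>t * min i 1\<close>.\<close>

lemma zero_mat_eq_jordan_blocks: "0\<^sub>m t t = diag_block_mat (replicate t (nilpotent_jordan_block (Suc 0)))"
proof (induction t)
  case 0
  show ?case by (auto intro!: eq_matI)
next
  case (Suc t)
  show ?case unfolding replicate_Suc diag_block_mat.simps Suc[symmetric] Let_def
    by (rule eq_matI) (auto simp: nilpotent_jordan_block_def)
qed

section \<open>Both directions of the classification\<close>

theorem theorem4p10:
  fixes n k t :: nat and M :: "real mat" and ns ps :: "nat \<Rightarrow> nat"
  assumes "n \<ge> 1"
    and "M \<in> carrier_mat (2 * n - 1) (2 * n - 1)"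
    and "nilpotent_mat M"
    and "jordan_type M k ns ps t"
  shows "(\<exists>j. complex_structure (almost_abelian M) j) \<longleftrightarrow>
      (odd t \<and> (\<forall>i \<in> {1..k}. even (ps i))) \<or>
      (odd t \<and> (\<forall>i \<in> {1..k - 1}. even (ps i)) \<and> ns k = 2 \<and> odd (ps k)) \<or>
      (even t \<and> k \<ge> 2 \<and>
        (\<exists>l \<in> {2..k}. ns (l - 1) = ns l + 1 \<and> odd (ps (l - 1)) \<and> odd (ps l) \<and>
          (\<forall>i \<in> {1..k} - {l - 1, l}. even (ps i))))"
proof -
  define d where "d = 2 * n - 1"
  let ?N = "nilpotent_jordan_block"
  define bs where "bs = concat (map (\<lambda>i. replicate (ps i) (?N (ns i))) [1..<Suc k])"
  have M: "M \<in> carrier_mat d d" using assms(2) by (simp add: d_def)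
  have k: "k \<ge> 1" and decr: "\<forall>i \<in> {1..k}. \<forall>i' \<in> {1..k}. i < i' \<longrightarrow> ns i' < ns i"
    and ns2: "\<forall>i \<in> {1..k}. ns i \<ge> 2" and dim: "(\<Sum>i = 1..k. ns i * ps i) + t = d"
    and sim: "similar_mat M (diag_block_mat (bs @ [0\<^sub>m t t]))"
    using assms(4) M by (auto simp: jordan_type_def bs_def)
  show ?thesis
  proof
    assume "(odd t \<and> (\<forall>i \<in> {1..k}. even (ps i))) \<or>
      (odd t \<and> (\<forall>i \<in> {1..k - 1}. even (ps i)) \<and> ns k = 2 \<and> odd (ps k)) \<or>
      (even t \<and> k \<ge> 2 \<and>
        (\<exists>l \<in> {2..k}. ns (l - 1) = ns l + 1 \<and> odd (ps (l - 1)) \<and> odd (ps l) \<and>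
          (\<forall>i \<in> {1..k} - {l - 1, l}. even (ps i))))"
    hence "admits_hyperplane_cs (diag_block_mat (bs @ [0\<^sub>m t t]))"
      unfolding bs_def by (rule admits_hyperplane_cs_jordan_blocks[OF k])
    then obtain J e \<phi> where "hyperplane_cs d M J e \<phi>"
      using admits_hyperplane_cs_similar[OF M sim] M by (auto simp: admits_hyperplane_cs_def)
    thus "\<exists>j. complex_structure (almost_abelian M) j"
      using complex_structure_almost_abelian_if_hyperplane_cs[OF M] by blast
  next
    assume "\<exists>j. complex_structure (almost_abelian M) j"
    then obtain j where j: "complex_structure (almost_abelian M) j" by blast
    obtain J \<phi> where J: "J \<in> carrier_mat d d" and \<phi>: "\<phi> \<in> carrier_vec d"
      and \<phi>J: "\<And>w. w \<in> carrier_vec d \<Longrightarrow> \<phi> \<bullet> w = 0 \<Longrightarrow> \<phi> \<bullet> (J *\<^sub>v w) = 0"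
      and JJ: "\<And>w. w \<in> carrier_vec d \<Longrightarrow> \<phi> \<bullet> w = 0 \<Longrightarrow> J *\<^sub>v (J *\<^sub>v w) = - w"
      and \<phi>M: "\<And>w. w \<in> carrier_vec d \<Longrightarrow> \<phi> \<bullet> w = 0 \<Longrightarrow> \<phi> \<bullet> (M *\<^sub>v w) = 0"
      and comm: "\<And>w. w \<in> carrier_vec d \<Longrightarrow> \<phi> \<bullet> w = 0 \<Longrightarrow> M *\<^sub>v (J *\<^sub>v w) = J *\<^sub>v (M *\<^sub>v w)"
      using hyperplane_of_complex_structure[OF M j] by blast
    have car: "M *\<^sub>v v \<in> carrier_vec d" "J *\<^sub>v v \<in> carrier_vec d" for v
      using M J unfolding carrier_vec_def by simp_all
    have Mi: "M ^\<^sub>m i \<in> carrier_mat d d" for i using M by (rule pow_carrier_mat)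
    have MSuc: "M ^\<^sub>m Suc i *\<^sub>v w = M ^\<^sub>m i *\<^sub>v (M *\<^sub>v w)" if "w \<in> carrier_vec d" for i w
      using assoc_mult_mat_vec[OF Mi M that] by simp
    \<comment> \<open>\<open>M\<close> preserves the kernel of \<open>\<phi>\<close>, so
      \<open>comm\<close> applies again to \<open>M *\<^sub>v w\<close> in the induction.\<close>
    have ker: "M ^\<^sub>m i *\<^sub>v (J *\<^sub>v w) = J *\<^sub>v (M ^\<^sub>m i *\<^sub>v w)" if "w \<in> carrier_vec d" "\<phi> \<bullet> w = 0" for i w
      using that
    proof (induction i arbitrary: w)
      case 0
      thus ?case using M car by simp
    next
      case (Suc i)
      thus ?case by (simp add: MSuc car comm \<phi>M del: pow_mat.simps)
    qed
    have J0: "J *\<^sub>v 0\<^sub>v d = 0\<^sub>v d" using J by (intro eq_vecI) auto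
    define N where "N i = (\<Sum>l = 1..k. ps l * min i (ns l)) + t * min i 1" for i
    have null: "has_nullity (M ^\<^sub>m i) (N i)" for i
    proof -
      \<comment> \<open>The sizes of all blocks with repetition, each dimension of the zero part
        counting as a block of size one.\<close>
      define ds where "ds = concat (map (\<lambda>l. replicate (ps l) (ns l)) [1..<Suc k]) @ replicate t (Suc 0)"
      have "bs @ replicate t (?N (Suc 0)) = map ?N ds"
        by (simp add: bs_def ds_def map_concat o_def del: upt_Suc)
      moreover have "diag_block_mat [0\<^sub>m t t] = diag_block_mat (replicate t (?N (Suc 0)))"
        using zero_mat_eq_jordan_blocks[of t] by (simp del: diag_block_mat.simps)
      ultimately have "diag_block_mat (bs @ [0\<^sub>m t t]) = diag_block_mat (map ?N ds)"
        by (metis diag_block_mat_append_dsum)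
      then obtain P Q where "similar_mat_wit M (diag_block_mat (map ?N ds)) P Q"
        using sim by (auto simp: similar_mat_def)
      hence "similar_mat_wit (M ^\<^sub>m i) (diag_block_mat (map ?N ds) ^\<^sub>m i) P Q"
        by (rule similar_mat_wit_pow)
      hence "has_nullity (M ^\<^sub>m i) (\<Sum>n \<leftarrow> ds. min i n)"
        by (rule has_nullity_similar[OF Mi _ has_nullity_jordan_blocks_pow])
      moreover have "(\<Sum>n \<leftarrow> concat (map (\<lambda>l. replicate (ps l) (ns l)) xs). min i n)
          = (\<Sum>l \<leftarrow> xs. ps l * min i (ns l))" for xs
        by (induction xs) (simp_all add: sum_list_replicate)
      hence "(\<Sum>n \<leftarrow> ds. min i n) = (\<Sum>l \<leftarrow> [1..<Suc k]. ps l * min i (ns l)) + t * min i 1"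
        by (simp add: ds_def sum_list_replicate del: upt_Suc)
      moreover have "(\<Sum>l \<leftarrow> [1..<Suc k]. ps l * min i (ns l)) = (\<Sum>l = 1..k. ps l * min i (ns l))"
        by (simp add: sum_list_distinct_conv_sum_set atLeastLessThanSuc_atLeastAtMost del: upt_Suc)
      ultimately show ?thesis by (simp add: N_def del: upt_Suc)
    qed
    have even_iff: "even (N i) \<longleftrightarrow> (\<forall>w \<in> carrier_vec d. M ^\<^sub>m i *\<^sub>v w = 0\<^sub>v d \<longrightarrow> \<phi> \<bullet> w = 0)" for i
      by (rule even_nullity_iff[OF Mi null J \<phi> \<phi>J JJ]) (simp_all add: ker J0)
    \<comment> \<open>The kernels of the powers increase, so if a later one lies in the kernel of
      \<open>\<phi>\<close>, the earlier ones do too. This supplies the monotonicity of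
      parities.\<close>
    have "M ^\<^sub>m Suc i *\<^sub>v w = 0\<^sub>v d" if "w \<in> carrier_vec d" "M ^\<^sub>m i *\<^sub>v w = 0\<^sub>v d" for i w
      using that
    proof (induction i arbitrary: w)
      case 0
      hence "w = 0\<^sub>v d" using M by simp
      thus ?case using M by (intro eq_vecI) auto
    next
      case (Suc i)
      thus ?case using MSuc car by metis
    qed
    hence "even (N i)" if "even (N (Suc i))" for i using that unfolding even_iff by blast
    moreover have "odd ((\<Sum>l = 1..k. ns l * ps l) + t)" using assms(1) unfolding dim d_def by simp
    ultimately show "(odd t \<and> (\<forall>i \<in> {1..k}. even (ps i))) \<or>
      (odd t \<and> (\<forall>i \<in> {1..k - 1}. even (ps i)) \<and> ns k = 2 \<and> odd (ps k)) \<or>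
      (even t \<and> k \<ge> 2 \<and>
        (\<exists>l \<in> {2..k}. ns (l - 1) = ns l + 1 \<and> odd (ps (l - 1)) \<and> odd (ps l) \<and>
          (\<forall>i \<in> {1..k} - {l - 1, l}. even (ps i))))"
      by (intro jordan_type_parity[OF k decr ns2, of N]) (auto simp: N_def)
  qed
qed

end
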